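(* Let $\mathbb{F}$ be the open filter monad on $\mathsf{X}=\mathsf{Top}_0$. The idempotent split completion of the Kleisli category $\mathsf{X}_{\mathbb{F}}$ (regarded, up to equivalence, as the full subcategory of split $\mathbb{F}$-algebras in $\mathsf{X}^{\mathbb{F}}=\mathsf{ContLat}$) is precisely the full subcategory of $\mathsf{ContLat}$ of all algebraic lattices whose subposet of compact elements is the dual of a frame.
   Context: $\mathsf{Top}_0$ is the category of $T_0$ topological spaces and continuous maps. The specialisation order on a space is: $x\le y$ iff every open set containing $x$ contains $y$; hom-sets of $\mathsf{Top}_0$ are ordered pointwise by it. An adjunction $f\dashv g$ with $f:X\to Y$, $g:Y\to X$ in $\mathsf{Top}_0$ means $\mathrm{id}_X\le g f$ and $f g\le\mathrm{id}_Y$. The open filter monad $\mathbb{F}=(F,m,e)$ on $\mathsf{Top}_0$: $FX$ is the set of all filters (the improper one included) of the lattice $\Omega X$ of open subsets of $X$, with topology generated by the sets $A^{\#}=\{\mathfrak{f}\in FX\mid A\in\mathfrak{f}\}$, $A\in\Omega X$; $Ff(\mathfrak{f})=\{B\mid f^{-1}(B)\in\mathfrak{f}\}$; $e_X(x)$ is the filter of open neighbourhoods of $x$; $m_X(\mathfrak{F})=\{A\in\Omega X\mid A^{\#}\in\mathfrak{F}\}$. It is of Kock-Zöberlein type with respect to the dual of the specialisation order, so algebra structures $\alpha:FX\to X$ are exactly the right adjoints of $e_X$ (i.e. $e_X\dashv\alpha$ in the specialisation order) and are unique when they exist. The Eilenberg-Moore category $\mathsf{X}^{\mathbb{F}}$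 is identified with the category $\mathsf{ContLat}$ of continuous lattices (with the Scott topology) and maps preserving directed suprema and arbitrary infima. An $\mathbb{F}$-algebra $A$ with structure $\alpha:FA\to A$ is split if there is a continuous map $t:A\to FA$ with $\alpha\dashv t$ (in the specialisation order). The idempotent split completion of the Kleisli category $\mathsf{X}_{\mathbb{F}}$ is equivalent to the full subcategory of $\mathsf{X}^{\mathbb{F}}$ of split $\mathbb{F}$-algebras, and is identified with it. An element $c$ of a poset with directed suprema is compact if, whenever $c\le\bigvee D$ with $D$ directed, $c\le d$ for some $d\in D$. An algebraic lattice is a complete lattice in which every element is the directed supremum of the compact elements below it. A frame is a complete lattice in which finite infima distribute over arbitrary suprema; so a poset is the dual of a frame iff it is a complete lattice in which finite suprema distribute over arbitrary infima. *)

theory Defs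
  imports "HOL-Analysis.Analysis" "HOL-Algebra.Complete_Lattice"
begin

section \<open>The specialisation order\<close>

definition spec_order :: "'a topology \<Rightarrow> 'a gorder" where
  "spec_order X =
     \<lparr> carrier = topspace X, eq = (=), le = (\<lambda>x y. \<forall>U. openin X U \<longrightarrow> x \<in> U \<longrightarrow> y \<in> U) \<rparr>"

text \<open>An adjunction \<open>f \<stileturn> g\<close> in the order-enriched category \<open>Top\<^sub>0\<close>; the inequalities between
  morphisms are pointwise in the specialisation orders.\<close>

definition top_adjunction ::
    "'a topology \<Rightarrow> 'b topology \<Rightarrow> ('a \<Rightarrow> 'b) \<Rightarrow> ('b \<Rightarrow> 'a) \<Rightarrow> bool" where
  "top_adjunction X Y f g \<longleftrightarrow>
     continuous_map X Y f \<and> continuous_map Y X g \<and>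
     (\<forall>x\<in>topspace X. x \<sqsubseteq>\<^bsub>spec_order X\<^esub> g (f x)) \<and>
     (\<forall>y\<in>topspace Y. f (g y) \<sqsubseteq>\<^bsub>spec_order Y\<^esub> y)"


section \<open>The open filter monad\<close>

text \<open>The improper filter (all open sets, equivalently a filter containing the empty set) is
  included.\<close>

definition open_filter :: "'a topology \<Rightarrow> 'a set set \<Rightarrow> bool" where
  "open_filter X \<ff> \<longleftrightarrow>
     (\<forall>A\<in>\<ff>. openin X A) \<and> topspace X \<in> \<ff> \<and>
     (\<forall>A\<in>\<ff>. \<forall>B\<in>\<ff>. A \<inter> B \<in> \<ff>) \<and>
     (\<forall>A\<in>\<ff>. \<forall>B. openin X B \<and> A \<subseteq> B \<longrightarrow> B \<in> \<ff>)"

definition sharp :: "'a topology \<Rightarrow> 'a set \<Rightarrow> 'a set set set" where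
  "sharp X A = {\<ff>. open_filter X \<ff> \<and> A \<in> \<ff>}"

definition F_space :: "'a topology \<Rightarrow> 'a set set topology" where
  "F_space X = topology_generated_by {sharp X A | A. openin X A}"

lemma topspace_F_space: "topspace (F_space X) = {\<ff>. open_filter X \<ff>}"
proof -
  have "sharp X (topspace X) = {\<ff>. open_filter X \<ff>}"
    by (simp add: sharp_def open_filter_def cong: conj_cong)
  moreover have "sharp X A \<subseteq> {\<ff>. open_filter X \<ff>}" for A
    by (simp add: sharp_def Collect_mono)
  ultimately have "\<Union>{sharp X A | A. openin X A} = {\<ff>. open_filter X \<ff>}"
    using openin_topspace[of X] by fast
  then show ?thesis
    by (simp add: F_space_def)
qed

definition F_map :: "'a topology \<Rightarrow> 'b topology \<Rightarrow> ('a \<Rightarrow> 'b) \<Rightarrow> 'a set set \<Rightarrow> 'b set set" where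
  "F_map X Y f \<ff> = {B. openin Y B \<and> {x \<in> topspace X. f x \<in> B} \<in> \<ff>}"

definition F_unit :: "'a topology \<Rightarrow> 'a \<Rightarrow> 'a set set" where
  "F_unit X x = {A. openin X A \<and> x \<in> A}"

definition F_mult :: "'a topology \<Rightarrow> 'a set set set set \<Rightarrow> 'a set set" where
  "F_mult X \<FF> = {A. openin X A \<and> sharp X A \<in> \<FF>}"


section \<open>Eilenberg-Moore algebras\<close>

definition F_algebra :: "'a topology \<Rightarrow> ('a set set \<Rightarrow> 'a) \<Rightarrow> bool" where
  "F_algebra X \<alpha> \<longleftrightarrow>
     t0_space X \<and> continuous_map (F_space X) X \<alpha> \<and>
     (\<forall>x\<in>topspace X. \<alpha> (F_unit X x) = x) \<and>
     (\<forall>\<FF>\<in>topspace (F_space (F_space X)).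
        \<alpha> (F_map (F_space X) X \<alpha> \<FF>) = \<alpha> (F_mult X \<FF>))"

definition F_hom ::
    "'a topology \<Rightarrow> ('a set set \<Rightarrow> 'a) \<Rightarrow> 'b topology \<Rightarrow> ('b set set \<Rightarrow> 'b) \<Rightarrow> ('a \<Rightarrow> 'b) \<Rightarrow> bool" where
  "F_hom X \<alpha> Y \<beta> f \<longleftrightarrow>
     continuous_map X Y f \<and>
     (\<forall>\<ff>\<in>topspace (F_space X). f (\<alpha> \<ff>) = \<beta> (F_map X Y f \<ff>))"

definition split_F_algebra :: "'a topology \<Rightarrow> ('a set set \<Rightarrow> 'a) \<Rightarrow> bool" where
  "split_F_algebra X \<alpha> \<longleftrightarrow> F_algebra X \<alpha> \<and> (\<exists>t. top_adjunction (F_space X) X \<alpha> t)"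


section \<open>Continuous and algebraic lattices\<close>

definition directed_in :: "'a gorder \<Rightarrow> 'a set \<Rightarrow> bool" where
  "directed_in L D \<longleftrightarrow>
     D \<subseteq> carrier L \<and> D \<noteq> {} \<and> (\<forall>x\<in>D. \<forall>y\<in>D. \<exists>z\<in>D. x \<sqsubseteq>\<^bsub>L\<^esub> z \<and> y \<sqsubseteq>\<^bsub>L\<^esub> z)"

definition way_below :: "'a gorder \<Rightarrow> 'a \<Rightarrow> 'a \<Rightarrow> bool" where
  "way_below L x y \<longleftrightarrow>
     (\<forall>D. directed_in L D \<and> y \<sqsubseteq>\<^bsub>L\<^esub> \<Squnion>\<^bsub>L\<^esub> D \<longrightarrow> (\<exists>d\<in>D. x \<sqsubseteq>\<^bsub>L\<^esub> d))"

definition continuous_lattice :: "'a gorder \<Rightarrow> bool" where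
  "continuous_lattice L \<longleftrightarrow>
     complete_lattice L \<and>
     (\<forall>x\<in>carrier L. x = \<Squnion>\<^bsub>L\<^esub> {y \<in> carrier L. way_below L y x})"

definition compacts :: "'a gorder \<Rightarrow> 'a set" where
  "compacts L =
     {c \<in> carrier L. \<forall>D. directed_in L D \<and> c \<sqsubseteq>\<^bsub>L\<^esub> \<Squnion>\<^bsub>L\<^esub> D \<longrightarrow> (\<exists>d\<in>D. c \<sqsubseteq>\<^bsub>L\<^esub> d)}"

definition algebraic_lattice :: "'a gorder \<Rightarrow> bool" where
  "algebraic_lattice L \<longleftrightarrow>
     complete_lattice L \<and>
     (\<forall>x\<in>carrier L. directed_in L {c \<in> compacts L. c \<sqsubseteq>\<^bsub>L\<^esub> x} \<and>
                     x = \<Squnion>\<^bsub>L\<^esub> {c \<in> compacts L. c \<sqsubseteq>\<^bsub>L\<^esub> x})"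

definition ContLat_hom :: "'a gorder \<Rightarrow> 'b gorder \<Rightarrow> ('a \<Rightarrow> 'b) \<Rightarrow> bool" where
  "ContLat_hom L M f \<longleftrightarrow>
     f \<in> carrier L \<rightarrow> carrier M \<and>
     (\<forall>D. directed_in L D \<longrightarrow> f (\<Squnion>\<^bsub>L\<^esub> D) = \<Squnion>\<^bsub>M\<^esub> (f ` D)) \<and>
     (\<forall>S. S \<subseteq> carrier L \<longrightarrow> f (\<Sqinter>\<^bsub>L\<^esub> S) = \<Sqinter>\<^bsub>M\<^esub> (f ` S))"


section \<open>The Scott topology\<close>

definition scott_open :: "'a gorder \<Rightarrow> 'a set \<Rightarrow> bool" where
  "scott_open L U \<longleftrightarrow>
     U \<subseteq> carrier L \<and>
     (\<forall>x\<in>U. \<forall>y\<in>carrier L. x \<sqsubseteq>\<^bsub>L\<^esub> y \<longrightarrow> y \<in> U) \<and>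
     (\<forall>D. directed_in L D \<and> \<Squnion>\<^bsub>L\<^esub> D \<in> U \<longrightarrow> D \<inter> U \<noteq> {})"

definition scott_topology :: "'a gorder \<Rightarrow> 'a topology" where
  "scott_topology L = topology (scott_open L)"

lemma scott_open_subset: "scott_open L U \<Longrightarrow> U \<subseteq> carrier L"
  by (simp add: scott_open_def)

lemma scott_open_upper:
  assumes "scott_open L U" "x \<in> U" "y \<in> carrier L" "x \<sqsubseteq>\<^bsub>L\<^esub> y"
  shows "y \<in> U"
proof -
  have "\<forall>x\<in>U. \<forall>y\<in>carrier L. x \<sqsubseteq>\<^bsub>L\<^esub> y \<longrightarrow> y \<in> U"
    using assms(1) by (simp add: scott_open_def)
  from this[rule_format, OF assms(2,3,4)] show ?thesis .
qed

lemma scott_open_inaccessible: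
  "scott_open L U \<Longrightarrow> directed_in L D \<Longrightarrow> \<Squnion>\<^bsub>L\<^esub> D \<in> U \<Longrightarrow> D \<inter> U \<noteq> {}"
  by (simp add: scott_open_def)

lemma istopology_scott_open: "istopology (scott_open L)"
  unfolding istopology_def
proof (intro conjI allI impI)
  fix S T assume S: "scott_open L S" and T: "scott_open L T"
  have meets: "D \<inter> (S \<inter> T) \<noteq> {}" if D: "directed_in L D \<and> \<Squnion>\<^bsub>L\<^esub> D \<in> S \<inter> T" for D
  proof -
    have "D \<inter> S \<noteq> {}" "D \<inter> T \<noteq> {}"
      using scott_open_inaccessible[OF S] scott_open_inaccessible[OF T] D by simp_all
    then obtain x y where x: "x \<in> D" "x \<in> S" and y: "y \<in> D" "y \<in> T"
      by auto
    have "\<forall>x\<in>D. \<forall>y\<in>D. \<exists>z\<in>D. x \<sqsubseteq>\<^bsub>L\<^esub> z \<and> y \<sqsubseteq>\<^bsub>L\<^esub> z"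
      using D by (simp add: directed_in_def)
    from this[rule_format, OF x(1) y(1)]
    obtain z where z: "z \<in> D" "x \<sqsubseteq>\<^bsub>L\<^esub> z" "y \<sqsubseteq>\<^bsub>L\<^esub> z" by auto
    have "D \<subseteq> carrier L"
      using D by (simp add: directed_in_def)
    with z(1) have "z \<in> carrier L" by auto
    then have "z \<in> S" "z \<in> T"
      using scott_open_upper[OF S x(2) _ z(2)] scott_open_upper[OF T y(2) _ z(3)] by simp_all
    with z show ?thesis by auto
  qed
  have "S \<inter> T \<subseteq> carrier L"
    using scott_open_subset[OF S] by auto
  moreover have "\<forall>x\<in>S \<inter> T. \<forall>y\<in>carrier L. x \<sqsubseteq>\<^bsub>L\<^esub> y \<longrightarrow> y \<in> S \<inter> T"
  proof (intro ballI impI)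
    fix x y assume x: "x \<in> S \<inter> T" and y: "y \<in> carrier L" "x \<sqsubseteq>\<^bsub>L\<^esub> y"
    from x have "x \<in> S" "x \<in> T" by simp_all
    with y show "y \<in> S \<inter> T"
      using scott_open_upper[OF S, of x y] scott_open_upper[OF T, of x y] by simp
  qed
  ultimately show "scott_open L (S \<inter> T)"
    using meets unfolding scott_open_def by (intro conjI allI impI)
next
  fix K assume K: "\<forall>S\<in>K. scott_open L S"
  have "D \<inter> \<Union>K \<noteq> {}" if "directed_in L D \<and> \<Squnion>\<^bsub>L\<^esub> D \<in> \<Union>K" for D
  proof -
    from that obtain S where S: "S \<in> K" "\<Squnion>\<^bsub>L\<^esub> D \<in> S" by auto
    from K S(1) have "scott_open L S" by simp
    from scott_open_inaccessible[OF this _ S(2)] have "D \<inter> S \<noteq> {}" using that by simp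
    with S show ?thesis by auto
  qed
  moreover have "\<Union>K \<subseteq> carrier L"
  proof (rule Union_least)
    fix S assume "S \<in> K"
    with K have "scott_open L S" by simp
    then show "S \<subseteq> carrier L" by (rule scott_open_subset)
  qed
  moreover have "\<forall>x\<in>\<Union>K. \<forall>y\<in>carrier L. x \<sqsubseteq>\<^bsub>L\<^esub> y \<longrightarrow> y \<in> \<Union>K"
  proof (intro ballI impI)
    fix x y assume "x \<in> \<Union>K" and y: "y \<in> carrier L" "x \<sqsubseteq>\<^bsub>L\<^esub> y"
    then obtain S where S: "S \<in> K" "x \<in> S" by auto
    from K S(1) have "scott_open L S" by simp
    from scott_open_upper[OF this S(2) y] have "y \<in> S" .
    with S show "y \<in> \<Union>K" by auto
  qed
  ultimately show "scott_open L (\<Union>K)"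
    unfolding scott_open_def by (intro conjI allI impI)
qed

lemma openin_scott_topology: "openin (scott_topology L) = scott_open L"
  by (simp add: scott_topology_def istopology_scott_open)

lemma topspace_scott_topology: "topspace (scott_topology L) = carrier L"
proof (rule subset_antisym)
  have "D \<inter> carrier L \<noteq> {}" if "directed_in L D" for D
  proof -
    have "D \<subseteq> carrier L" "D \<noteq> {}"
      using that by (simp_all add: directed_in_def)
    then show ?thesis by auto
  qed
  then have "openin (scott_topology L) (carrier L)"
    by (simp add: openin_scott_topology scott_open_def)
  then show "carrier L \<subseteq> topspace (scott_topology L)"
    by (rule openin_subset)
next
  have "scott_open L (topspace (scott_topology L))"
    using openin_topspace[of "scott_topology L"] unfolding openin_scott_topology .
  then show "topspace (scott_topology L) \<subseteq> carrier L"
    by (rule scott_open_subset)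
qed


section \<open>Frames\<close>

definition frame :: "'a gorder \<Rightarrow> bool" where
  "frame L \<longleftrightarrow>
     complete_lattice L \<and>
     (\<forall>a\<in>carrier L. \<forall>S. S \<subseteq> carrier L \<longrightarrow>
        a \<sqinter>\<^bsub>L\<^esub> (\<Squnion>\<^bsub>L\<^esub> S) = \<Squnion>\<^bsub>L\<^esub> ((\<lambda>s. a \<sqinter>\<^bsub>L\<^esub> s) ` S))"

definition dual_of_frame :: "'a gorder \<Rightarrow> bool" where
  "dual_of_frame L \<longleftrightarrow> frame (inv_gorder L)"

text \<open>Suprema and infima in the subposet of compact elements are those of that subposet; its
  infima need not be the ones of \<open>L\<close>.\<close>

definition compact_poset :: "'a gorder \<Rightarrow> 'a gorder" where
  "compact_poset L = L\<lparr>carrier := compacts L\<rparr>"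

definition algebraic_lattice_with_coframe_of_compacts :: "'a gorder \<Rightarrow> bool" where
  "algebraic_lattice_with_coframe_of_compacts L \<longleftrightarrow>
     algebraic_lattice L \<and> dual_of_frame (compact_poset L)"

text \<open>Equality of posets, disregarding the values of the order relation outside the carrier.\<close>

definition same_poset :: "'a gorder \<Rightarrow> 'a gorder \<Rightarrow> bool" where
  "same_poset L M \<longleftrightarrow>
     carrier L = carrier M \<and>
     (\<forall>x\<in>carrier L. \<forall>y\<in>carrier L. x \<sqsubseteq>\<^bsub>L\<^esub> y \<longleftrightarrow> x \<sqsubseteq>\<^bsub>M\<^esub> y)"

end

theory Submission
  imports Defs
begin

text \<open>A continuous retraction \<open>\<alpha>\<close> of the unit \<open>e\<close> is automatically right adjoint to it, so
  \<open>\<alpha> \<ff>\<close> is the largest \<open>x\<close> all of whose open neighbourhoods belong to \<open>\<ff>\<close>. Applied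
  to principal filters this yields all infima, and continuity of \<open>\<alpha>\<close> yields
  \<open>\<alpha> \<ff> = \<Squnion>{\<Sqinter>A | A \<in> \<ff>}\<close> as a directed supremum; hence the topology is the Scott
  topology and the lattice is continuous. A further right adjoint of \<open>\<alpha>\<close> can only be
  \<open>x \<mapsto> {U. \<Sqinter>U \<sqsubseteq> x}\<close>. It exists and is continuous iff every \<open>\<Sqinter>U\<close>, for \<open>U\<close> open, is
  compact and \<open>\<Sqinter>(U \<inter> V) = \<Sqinter>U \<squnion> \<Sqinter>V\<close>. The compact elements are then exactly the
  \<open>\<Sqinter>U\<close>, and these two conditions say that they are closed under infima and that binary
  joins distribute over these.\<close>

text \<open>As classical rules, these make proof search diverge.\<close>
declare (in weak_partial_order)
  weak_le_antisym [rule del] le_cong_l [rule del] le_cong_r [rule del] weak_refl [rule del]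
  mem_imp_elem [rule del] is_closed_eq [rule del] is_closed_eq_rev [rule del]
  Upper_elemD [rule del]
declare (in partial_order) le_antisym [rule del]
declare least_closed [rule del] greatest_closed [rule del]

section \<open>Open filters\<close>

text \<open>The last equivalence rests on a passage between open sets and sets of compact elements.
  A set \<open>S\<close> of compact elements yields the open union of their principal up-sets, an
  open set \<open>U\<close> yields its compact members, and in an algebraic lattice neither step
  changes the infimum. The up-sets of \<open>a\<close> and \<open>s\<close> meet in the up-set of
  \<open>a \<squnion> s\<close>, so intersecting opens corresponds to joining compact elements. The
  condition on \<open>U \<inter> V\<close> thus becomes distributivity, applied once for each of the
  two opens. The delicate point is that infima in the subposet of compact elements are a priori not
  those of the lattice; they have to be identified before the two laws can be compared.\<close>

definition open_supersets :: "'a topology \<Rightarrow> 'a set \<Rightarrow> 'a set set" where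
  "open_supersets X S = {B. openin X B \<and> S \<subseteq> B}"

lemma open_filter_openin: "open_filter X \<ff> \<Longrightarrow> A \<in> \<ff> \<Longrightarrow> openin X A"
  by (simp add: open_filter_def)

lemma open_filter_subset: "open_filter X \<ff> \<Longrightarrow> A \<in> \<ff> \<Longrightarrow> A \<subseteq> topspace X"
  by (simp add: open_filter_openin openin_subset)

lemma open_filter_upper:
  "open_filter X \<ff> \<Longrightarrow> A \<in> \<ff> \<Longrightarrow> openin X B \<Longrightarrow> A \<subseteq> B \<Longrightarrow> B \<in> \<ff>"
  unfolding open_filter_def by blast

lemma open_filter_Int: "open_filter X \<ff> \<Longrightarrow> A \<in> \<ff> \<Longrightarrow> B \<in> \<ff> \<Longrightarrow> A \<inter> B \<in> \<ff>"
  unfolding open_filter_def by blast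

lemma open_filter_topspace: "open_filter X \<ff> \<Longrightarrow> topspace X \<in> \<ff>"
  unfolding open_filter_def by blast

text \<open>The set \<open>S\<close> is arbitrary, not just open: singletons give the neighbourhood
  filters, and arbitrary subsets are what produce all infima in \<open>is_glb_alpha\<close>.\<close>

lemma open_filter_open_supersets:
  "S \<subseteq> topspace X \<Longrightarrow> open_filter X (open_supersets X S)"
  unfolding open_filter_def open_supersets_def by auto

lemma F_unit_eq: "F_unit X x = open_supersets X {x}"
  by (simp add: F_unit_def open_supersets_def)

lemma open_filter_F_unit: "x \<in> topspace X \<Longrightarrow> open_filter X (F_unit X x)"
  by (simp add: F_unit_eq open_filter_open_supersets)

lemma open_filter_F_map:
  assumes f: "continuous_map X Y f" and \<ff>: "open_filter X \<ff>"
  shows "open_filter Y (F_map X Y f \<ff>)"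
  unfolding open_filter_def
proof (intro conjI ballI allI impI)
  have pre: "openin X {x \<in> topspace X. f x \<in> B}" if "openin Y B" for B
    using openin_continuous_map_preimage[OF f that] .
  have "{x \<in> topspace X. f x \<in> topspace Y} = topspace X"
    using f by (auto simp: continuous_map_def)
  then show "topspace Y \<in> F_map X Y f \<ff>"
    using open_filter_topspace[OF \<ff>] by (simp add: F_map_def)
  fix A assume A: "A \<in> F_map X Y f \<ff>"
  then show "openin Y A" by (simp add: F_map_def)
  show "A \<inter> B \<in> F_map X Y f \<ff>" if B: "B \<in> F_map X Y f \<ff>" for B
  proof -
    have "{x \<in> topspace X. f x \<in> A} \<inter> {x \<in> topspace X. f x \<in> B} \<in> \<ff>"
      using A B by (intro open_filter_Int[OF \<ff>]) (simp_all add: F_map_def)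
    moreover have "{x \<in> topspace X. f x \<in> A} \<inter> {x \<in> topspace X. f x \<in> B}
        = {x \<in> topspace X. f x \<in> A \<inter> B}" by auto
    ultimately show ?thesis using A B by (simp add: F_map_def openin_Int)
  qed
  show "B \<in> F_map X Y f \<ff>" if B: "openin Y B \<and> A \<subseteq> B" for B
    using A B open_filter_upper[OF \<ff>, of "{x \<in> topspace X. f x \<in> A}" "{x \<in> topspace X. f x \<in> B}"]
      pre by (auto simp: F_map_def)
qed

section \<open>The topology of the filter space\<close>

lemma openin_sharp: "openin X A \<Longrightarrow> openin (F_space X) (sharp X A)"
  unfolding F_space_def by (rule topology_generated_by_Basis) blast

lemma sharp_mono: "openin X B \<Longrightarrow> A \<subseteq> B \<Longrightarrow> sharp X A \<subseteq> sharp X B"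
  by (auto simp: sharp_def intro: open_filter_upper)

text \<open>Because \<open>sharp X A \<inter> sharp X B = sharp X (A \<inter> B)\<close>, the
  generating sets form a basis and not merely a subbasis; closure of \<open>\<ff>\<close> under
  intersection keeps the chosen index inside \<open>\<ff>\<close>.\<close>

lemma openin_F_space_basis:
  assumes W: "openin (F_space X) W" and \<ff>: "open_filter X \<ff>" "\<ff> \<in> W"
  shows "\<exists>A\<in>\<ff>. sharp X A \<subseteq> W"
proof -
  have "generate_topology_on {sharp X A |A. openin X A} W"
    using W by (simp add: F_space_def openin_topology_generated_by_iff)
  then show ?thesis using \<ff>(2)
  proof (induction rule: generate_topology_on.induct)
    case (Int a b)
    then obtain A B where A: "A \<in> \<ff>" "sharp X A \<subseteq> a" and B: "B \<in> \<ff>" "sharp X B \<subseteq> b"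
      by blast
    have "sharp X (A \<inter> B) \<subseteq> sharp X A" "sharp X (A \<inter> B) \<subseteq> sharp X B"
      using A B open_filter_openin[OF \<ff>(1)] by (simp_all add: sharp_mono)
    then show ?case using A B open_filter_Int[OF \<ff>(1)] by blast
  next
    case (UN K)
    then show ?case by blast
  next
    case (Basis s)
    then show ?case by (auto simp: sharp_def)
  qed simp
qed

lemma openin_F_spaceI:
  assumes "W \<subseteq> {\<ff>. open_filter X \<ff>}" "\<And>\<ff>. \<ff> \<in> W \<Longrightarrow> \<exists>A\<in>\<ff>. sharp X A \<subseteq> W"
  shows "openin (F_space X) W"
proof (subst openin_subopen, intro ballI)
  fix \<ff> assume \<ff>: "\<ff> \<in> W"
  then obtain A where "A \<in> \<ff>" "sharp X A \<subseteq> W" using assms(2) by blast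
  then show "\<exists>T. openin (F_space X) T \<and> \<ff> \<in> T \<and> T \<subseteq> W"
    using \<ff> assms(1) by (intro exI[of _ "sharp X A"])
      (auto simp: sharp_def intro: open_filter_openin openin_sharp[unfolded sharp_def])
qed

text \<open>A generating open tests membership of a single open set, which gives inclusion.
  Conversely an open set around \<open>\<ff>\<close> contains \<open>sharp X A\<close> for some
  \<open>A\<close> in \<open>\<ff>\<close>, and a larger filter contains the same
  \<open>A\<close>.\<close>

lemma le_F_space_iff:
  assumes "open_filter X \<ff>" "open_filter X \<gg>"
  shows "\<ff> \<sqsubseteq>\<^bsub>spec_order (F_space X)\<^esub> \<gg> \<longleftrightarrow> \<ff> \<subseteq> \<gg>"
proof
  assume le: "\<ff> \<sqsubseteq>\<^bsub>spec_order (F_space X)\<^esub> \<gg>"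
  show "\<ff> \<subseteq> \<gg>"
  proof
    fix A assume "A \<in> \<ff>"
    then have "openin (F_space X) (sharp X A)" "\<ff> \<in> sharp X A"
      using assms by (auto simp: sharp_def intro: open_filter_openin openin_sharp[unfolded sharp_def])
    then have "\<gg> \<in> sharp X A" using le by (auto simp: spec_order_def)
    then show "A \<in> \<gg>" by (simp add: sharp_def)
  qed
next
  assume sub: "\<ff> \<subseteq> \<gg>"
  have "\<gg> \<in> W" if W: "openin (F_space X) W" "\<ff> \<in> W" for W
    using openin_F_space_basis[OF W(1) assms(1) W(2)] sub assms(2) by (auto simp: sharp_def)
  then show "\<ff> \<sqsubseteq>\<^bsub>spec_order (F_space X)\<^esub> \<gg>" by (simp add: spec_order_def)
qed


text \<open>Restricts the order to the unextended record type, on which \<open>directed_in\<close>,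
  \<open>way_below\<close> and \<open>compacts\<close> are defined.\<close>

locale gorder_complete_lattice = complete_lattice L for L :: "'a gorder" (structure)

text \<open>Shrinking a set raises its infimum, so closure of a filter under intersection becomes
  directedness. This is what allows Scott openness to be applied to a supremum of such
  infima.\<close>

lemma (in gorder_complete_lattice) directed_infs:
  assumes X: "carrier L = topspace X" and \<ff>: "open_filter X \<ff>"
  shows "directed_in L {\<Sqinter>\<^bsub>L\<^esub> A | A. A \<in> \<ff>}"
  unfolding directed_in_def
proof (intro conjI ballI)
  have c: "A \<subseteq> carrier L" if "A \<in> \<ff>" for A
    using that open_filter_subset[OF \<ff>] X by simp
  then show "{\<Sqinter>\<^bsub>L\<^esub> A | A. A \<in> \<ff>} \<subseteq> carrier L" by auto
  show "{\<Sqinter>\<^bsub>L\<^esub> A | A. A \<in> \<ff>} \<noteq> {}" using open_filter_topspace[OF \<ff>] by blast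
  fix x y assume "x \<in> {\<Sqinter>\<^bsub>L\<^esub> A | A. A \<in> \<ff>}" "y \<in> {\<Sqinter>\<^bsub>L\<^esub> A | A. A \<in> \<ff>}"
  then obtain A B where AB: "A \<in> \<ff>" "x = \<Sqinter>\<^bsub>L\<^esub> A" "B \<in> \<ff>" "y = \<Sqinter>\<^bsub>L\<^esub> B" by blast
  have "A \<inter> B \<subseteq> carrier L" using c AB by blast
  then have "x \<sqsubseteq> \<Sqinter>\<^bsub>L\<^esub> (A \<inter> B)" "y \<sqsubseteq> \<Sqinter>\<^bsub>L\<^esub> (A \<inter> B)"
    unfolding AB(2,4) using c AB by (blast intro!: inf_greatest inf_closed intro: inf_lower)+
  then show "\<exists>z\<in>{\<Sqinter>\<^bsub>L\<^esub> A | A. A \<in> \<ff>}. x \<sqsubseteq> z \<and> y \<sqsubseteq> z"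
    using open_filter_Int[OF \<ff> AB(1,3)] by blast
qed


section \<open>Algebras of the open filter monad as right adjoints of the unit\<close>

text \<open>The order is kept abstract and tied to the topology only on the carrier. One development
  then covers both \<open>spec_order X\<close> and a given lattice with its Scott topology, whose
  specialisation order agrees with the lattice order only on the carrier.\<close>

locale specialization = partial_order L for L :: "'a gorder" (structure) +
  fixes X :: "'a topology"
  assumes carrier_eq: "carrier L = topspace X"
    and le_iff: "x \<in> carrier L \<Longrightarrow> y \<in> carrier L \<Longrightarrow>
      x \<sqsubseteq> y \<longleftrightarrow> (\<forall>U. openin X U \<longrightarrow> x \<in> U \<longrightarrow> y \<in> U)"
begin

lemma openin_carrier: "openin X U \<Longrightarrow> U \<subseteq> carrier L"
  using openin_subset carrier_eq by simp

lemma open_upper: "openin X U \<Longrightarrow> x \<in> U \<Longrightarrow> y \<in> carrier L \<Longrightarrow> x \<sqsubseteq> y \<Longrightarrow> y \<in> U"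
  using le_iff[of x y] openin_carrier[of U] by blast

lemma t0: "t0_space X"
  unfolding t0_space_def
proof (intro ballI impI)
  fix x y assume xy: "x \<in> topspace X" "y \<in> topspace X" "x \<noteq> y"
  then have xy': "x \<in> carrier L" "y \<in> carrier L" using carrier_eq by simp_all
  then have "\<not> (x \<sqsubseteq> y \<and> y \<sqsubseteq> x)" using le_antisym xy(3) by blast
  then show "\<exists>U. openin X U \<and> (x \<notin> U \<longleftrightarrow> y \<in> U)"
    unfolding le_iff[OF xy'] le_iff[OF xy'(2,1)] by blast
qed

end

text \<open>Common ground for the two sources of algebras: an arbitrary \<open>F_algebra\<close>,
  and the map built from a continuous lattice, for which continuity and the unit law are the facts
  verified directly.\<close>

locale kz_algebra = specialization L X for L :: "'a gorder" (structure) and X +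
  fixes \<alpha> :: "'a set set \<Rightarrow> 'a"
  assumes continuous: "continuous_map (F_space X) X \<alpha>"
    and unit: "x \<in> carrier L \<Longrightarrow> \<alpha> (F_unit X x) = x"
begin

lemma alpha_closed: "open_filter X \<ff> \<Longrightarrow> \<alpha> \<ff> \<in> carrier L"
  using continuous carrier_eq topspace_F_space[of X] by (auto simp: continuous_map_def)

text \<open>Continuity of \<open>\<alpha>\<close> read on the basis. Its uses differ only in the
  choice of \<open>\<gg>\<close>: a larger filter gives monotonicity, the neighbourhood filter of a
  point of \<open>A\<close> gives \<open>A \<subseteq> U\<close>, and the principal filter of
  \<open>A\<close> puts the infimum of \<open>A\<close> into \<open>U\<close>.\<close>

lemma alpha_nhd:
  assumes "open_filter X \<ff>" "openin X U" "\<alpha> \<ff> \<in> U"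
  obtains A where "A \<in> \<ff>" "\<And>\<gg>. open_filter X \<gg> \<Longrightarrow> A \<in> \<gg> \<Longrightarrow> \<alpha> \<gg> \<in> U"
proof -
  have "openin (F_space X) {\<gg> \<in> topspace (F_space X). \<alpha> \<gg> \<in> U}"
    using openin_continuous_map_preimage[OF continuous assms(2)] .
  from openin_F_space_basis[OF this assms(1)] obtain A
    where "A \<in> \<ff>" "sharp X A \<subseteq> {\<gg> \<in> topspace (F_space X). \<alpha> \<gg> \<in> U}"
    using assms by (auto simp: topspace_F_space)
  then show ?thesis using that by (auto simp: sharp_def)
qed

lemma alpha_mono:
  assumes "open_filter X \<ff>" "open_filter X \<gg>" "\<ff> \<subseteq> \<gg>"
  shows "\<alpha> \<ff> \<sqsubseteq> \<alpha> \<gg>"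
proof -
  have "\<alpha> \<gg> \<in> U" if "openin X U" "\<alpha> \<ff> \<in> U" for U
    using alpha_nhd[OF assms(1) that] assms by (metis subsetD)
  then show ?thesis using le_iff alpha_closed assms by simp
qed

text \<open>An open neighbourhood \<open>U\<close> of \<open>\<alpha> \<ff>\<close> contains \<open>\<alpha>[A\<^sup>#]\<close> for some \<open>A \<in> \<ff>\<close>, hence contains
  \<open>A\<close> by the unit law; so \<open>e (\<alpha> \<ff>) \<subseteq> \<ff>\<close>.\<close>

lemma le_alpha_iff:
  assumes \<ff>: "open_filter X \<ff>" and x: "x \<in> carrier L"
  shows "x \<sqsubseteq> \<alpha> \<ff> \<longleftrightarrow> F_unit X x \<subseteq> \<ff>"
proof
  assume le: "x \<sqsubseteq> \<alpha> \<ff>"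
  show "F_unit X x \<subseteq> \<ff>"
  proof
    fix U assume "U \<in> F_unit X x"
    then have U: "openin X U" "x \<in> U" by (simp_all add: F_unit_def)
    then have "\<alpha> \<ff> \<in> U" using le open_upper alpha_closed[OF \<ff>] by blast
    from alpha_nhd[OF \<ff> U(1) this] obtain A
      where A: "A \<in> \<ff>" "\<And>\<gg>. open_filter X \<gg> \<Longrightarrow> A \<in> \<gg> \<Longrightarrow> \<alpha> \<gg> \<in> U" by blast
    have "a \<in> U" if a: "a \<in> A" for a
    proof -
      have "a \<in> carrier L" using a A(1) open_filter_subset[OF \<ff>] carrier_eq by blast
      then show ?thesis
        using A(2)[of "F_unit X a"] a open_filter_openin[OF \<ff> A(1)] unit carrier_eq
        by (simp add: open_filter_F_unit) (simp add: F_unit_def)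
    qed
    then show "U \<in> \<ff>" using open_filter_upper[OF \<ff> A(1) U(1)] by blast
  qed
next
  assume "F_unit X x \<subseteq> \<ff>"
  then show "x \<sqsubseteq> \<alpha> \<ff>"
    using alpha_mono[OF open_filter_F_unit \<ff>, of x] x unit[OF x] carrier_eq by simp
qed

text \<open>By \<open>le_alpha_iff\<close>, \<open>y\<close> lies below this value iff every open
  neighbourhood of \<open>y\<close> contains \<open>S\<close>, which in the specialisation order
  says that \<open>y\<close> is a lower bound of \<open>S\<close>.\<close>

lemma is_glb_alpha:
  assumes S: "S \<subseteq> carrier L"
  shows "is_glb L (\<alpha> (open_supersets X S)) S"
proof -
  have flt: "open_filter X (open_supersets X S)"
    using S carrier_eq by (simp add: open_filter_open_supersets)
  show ?thesis
  proof (rule greatest_LowerI[OF _ _ S alpha_closed[OF flt]])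
    show "\<alpha> (open_supersets X S) \<sqsubseteq> s" if s: "s \<in> S" for s
    proof -
      have sc: "s \<in> topspace X" using s S carrier_eq by blast
      have "open_supersets X S \<subseteq> F_unit X s"
        using s by (auto simp: F_unit_def open_supersets_def)
      then have "\<alpha> (open_supersets X S) \<sqsubseteq> \<alpha> (F_unit X s)"
        using alpha_mono flt open_filter_F_unit[OF sc] by blast
      then show ?thesis using unit sc carrier_eq by simp
    qed
    show "y \<sqsubseteq> \<alpha> (open_supersets X S)" if y: "y \<in> Lower L S" for y
    proof -
      have yc: "y \<in> carrier L" using y Lower_closed by (rule subsetD[rotated])
      have "s \<in> U" if "openin X U" "y \<in> U" "s \<in> S" for U s
      proof -
        have "y \<sqsubseteq> s" "s \<in> carrier L"
          using y that(3) S Lower_memD[of y L S s] by auto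
        then show ?thesis using open_upper that by blast
      qed
      then have "F_unit X y \<subseteq> open_supersets X S"
        by (auto simp: F_unit_def open_supersets_def)
      then show ?thesis using le_alpha_iff[OF flt yc] by simp
    qed
  qed
qed

end

sublocale kz_algebra \<subseteq> gorder_complete_lattice L
proof (rule gorder_complete_lattice.intro, rule complete_lattice_criterion1)
  \<comment> \<open>The top element is the infimum of the empty set, that is, the value of
    \<open>\<alpha>\<close> at the improper filter \<open>open_supersets X {}\<close>.\<close>
  show "\<exists>g. greatest L g (carrier L)"
    using is_glb_alpha[OF empty_subsetI] unfolding Lower_empty by (rule exI)
  show "\<exists>i. is_glb L i A" if "A \<subseteq> carrier L" for A
    using is_glb_alpha[OF that] by (rule exI)
qed

section \<open>Infima, the Scott topology and associativity for an algebra\<close>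

context kz_algebra
begin

lemma inf_eq_alpha: "S \<subseteq> carrier L \<Longrightarrow> \<Sqinter>\<^bsub>L\<^esub> S = \<alpha> (open_supersets X S)"
  using is_glb_alpha inf_glb weak_greatest_unique eq_is_equal by metis

lemma open_filter_inf_closed:
  "open_filter X \<ff> \<Longrightarrow> A \<in> \<ff> \<Longrightarrow> \<Sqinter>\<^bsub>L\<^esub> A \<in> carrier L"
  using open_filter_openin openin_carrier by (metis inf_closed)

lemma inf_le_alpha:
  assumes "open_filter X \<ff>" "A \<in> \<ff>"
  shows "\<Sqinter>\<^bsub>L\<^esub> A \<sqsubseteq> \<alpha> \<ff>"
proof -
  have A: "A \<subseteq> carrier L" using open_filter_subset[OF assms] carrier_eq by simp
  have "open_supersets X A \<subseteq> \<ff>"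
    using open_filter_upper[OF assms] by (auto simp: open_supersets_def)
  then show ?thesis
    unfolding inf_eq_alpha[OF A]
    using alpha_mono open_filter_open_supersets assms A carrier_eq by metis
qed

lemma inf_in_open:
  assumes \<ff>: "open_filter X \<ff>" and U: "openin X U" "\<alpha> \<ff> \<in> U"
  obtains A where "A \<in> \<ff>" "\<Sqinter>\<^bsub>L\<^esub> A \<in> U"
proof -
  from alpha_nhd[OF \<ff> U] obtain A
    where A: "A \<in> \<ff>" "\<And>\<gg>. open_filter X \<gg> \<Longrightarrow> A \<in> \<gg> \<Longrightarrow> \<alpha> \<gg> \<in> U" by blast
  have sub: "A \<subseteq> topspace X" using open_filter_subset[OF \<ff> A(1)] .
  have "A \<in> open_supersets X A"
    using open_filter_openin[OF \<ff> A(1)] by (simp add: open_supersets_def)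
  then have "\<alpha> (open_supersets X A) \<in> U"
    using A(2)[OF open_filter_open_supersets[OF sub]] by simp
  then show ?thesis
    using that[OF A(1)] inf_eq_alpha[of A] sub carrier_eq by simp
qed

text \<open>Since opens are upper sets and \<open>D\<close> is directed, the opens meeting
  \<open>D\<close> form a filter. Its value bounds \<open>D\<close> from above, as every
  neighbourhood of a member of \<open>D\<close> meets \<open>D\<close>; and by the adjunction every
  open set around that value belongs to the filter, hence meets \<open>D\<close>.\<close>

lemma directed_sup_in_open:
  assumes D: "directed_in L D" and U: "openin X U" "\<Squnion>\<^bsub>L\<^esub> D \<in> U"
  shows "\<exists>d\<in>D. d \<in> U"
proof -
  define \<ff> where "\<ff> = {V. openin X V \<and> D \<inter> V \<noteq> {}}"
  have Dc: "D \<subseteq> carrier L" "D \<noteq> {}" using D by (auto simp: directed_in_def)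
  have \<ff>: "open_filter X \<ff>"
    unfolding open_filter_def
  proof (intro conjI ballI allI impI)
    fix A assume A: "A \<in> \<ff>"
    show "openin X A" using A by (simp add: \<ff>_def)
    show "A \<inter> B \<in> \<ff>" if B: "B \<in> \<ff>" for B
    proof -
      obtain a b where ab: "a \<in> D" "a \<in> A" "b \<in> D" "b \<in> B" using A B by (auto simp: \<ff>_def)
      then obtain z where z: "z \<in> D" "a \<sqsubseteq> z" "b \<sqsubseteq> z"
        using D unfolding directed_in_def by blast
      then have "z \<in> A" "z \<in> B"
        using ab A B Dc open_upper[of A a z] open_upper[of B b z] by (auto simp: \<ff>_def)
      then show ?thesis using A B z by (auto simp: \<ff>_def)
    qed
    show "B \<in> \<ff>" if "openin X B \<and> A \<subseteq> B" for B
      using that A by (auto simp: \<ff>_def)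
  next
    show "topspace X \<in> \<ff>" using Dc carrier_eq by (auto simp: \<ff>_def)
  qed
  have "d \<sqsubseteq> \<alpha> \<ff>" if d: "d \<in> D" for d
    using d Dc le_alpha_iff[OF \<ff>, of d] by (auto simp: F_unit_def \<ff>_def)
  then have "\<Squnion>\<^bsub>L\<^esub> D \<sqsubseteq> \<alpha> \<ff>"
    using sup_least[OF Dc(1) alpha_closed[OF \<ff>]] by blast
  then have "\<alpha> \<ff> \<in> U"
    using open_upper[OF U] alpha_closed[OF \<ff>] by blast
  then have "U \<in> F_unit X (\<alpha> \<ff>)" using U by (simp add: F_unit_def)
  moreover have "F_unit X (\<alpha> \<ff>) \<subseteq> \<ff>"
    using le_alpha_iff[OF \<ff> alpha_closed[OF \<ff>]] le_refl[OF alpha_closed[OF \<ff>]] by simp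
  ultimately show ?thesis by (auto simp: \<ff>_def)
qed

lemma alpha_eq_sup_infs:
  assumes \<ff>: "open_filter X \<ff>"
  shows "\<alpha> \<ff> = \<Squnion>\<^bsub>L\<^esub> {\<Sqinter>\<^bsub>L\<^esub> A | A. A \<in> \<ff>}"
proof -
  let ?I = "{\<Sqinter>\<^bsub>L\<^esub> A | A. A \<in> \<ff>}"
  have c: "?I \<subseteq> carrier L" using open_filter_inf_closed[OF \<ff>] by blast
  have sc: "\<Squnion>\<^bsub>L\<^esub> ?I \<in> carrier L" using sup_closed[OF c] .
  have "\<Squnion>\<^bsub>L\<^esub> ?I \<in> U" if U: "openin X U" "\<alpha> \<ff> \<in> U" for U
  proof -
    from inf_in_open[OF \<ff> U] obtain A where A: "A \<in> \<ff>" "\<Sqinter>\<^bsub>L\<^esub> A \<in> U" .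
    then have "\<Sqinter>\<^bsub>L\<^esub> A \<sqsubseteq> \<Squnion>\<^bsub>L\<^esub> ?I" using sup_upper[OF c] by blast
    then show ?thesis using open_upper[OF U(1) A(2) sc] by simp
  qed
  then have "\<alpha> \<ff> \<sqsubseteq> \<Squnion>\<^bsub>L\<^esub> ?I" using le_iff alpha_closed[OF \<ff>] sc by simp
  moreover have "\<Squnion>\<^bsub>L\<^esub> ?I \<sqsubseteq> \<alpha> \<ff>"
    using sup_least[OF c alpha_closed[OF \<ff>]] inf_le_alpha[OF \<ff>] by blast
  ultimately show ?thesis using le_antisym alpha_closed[OF \<ff>] sc by blast
qed

text \<open>For the converse, a point \<open>x\<close> is the directed supremum of the infima of its
  open neighbourhoods. A Scott open set around \<open>x\<close> contains one of these infima, and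
  with it the whole neighbourhood.\<close>

lemma openin_iff_scott_open: "openin X U \<longleftrightarrow> scott_open L U"
proof
  assume U: "openin X U"
  show "scott_open L U"
    unfolding scott_open_def
    using openin_carrier[OF U] open_upper[OF U] directed_sup_in_open[OF _ U] by blast
next
  assume U: "scott_open L U"
  have "\<exists>A. openin X A \<and> x \<in> A \<and> A \<subseteq> U" if x: "x \<in> U" for x
  proof -
    have xc: "x \<in> topspace X" using x scott_open_subset[OF U] carrier_eq by blast
    then have \<ff>: "open_filter X (F_unit X x)" by (rule open_filter_F_unit)
    have "\<Squnion>\<^bsub>L\<^esub> {\<Sqinter>\<^bsub>L\<^esub> A | A. A \<in> F_unit X x} \<in> U"
      using alpha_eq_sup_infs[OF \<ff>] unit xc x carrier_eq by simp
    then obtain A where A: "A \<in> F_unit X x" "\<Sqinter>\<^bsub>L\<^esub> A \<in> U"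
      using scott_open_inaccessible[OF U directed_infs[OF carrier_eq \<ff>]] by blast
    have "A \<subseteq> carrier L" using A openin_carrier by (simp add: F_unit_def)
    then have "A \<subseteq> U" using scott_open_upper[OF U A(2)] inf_lower by blast
    then show ?thesis using A by (auto simp: F_unit_def)
  qed
  then show "openin X U" by (subst openin_subopen) blast
qed

lemma scott_topology_eq: "scott_topology L = X"
  by (simp add: topology_eq openin_scott_topology openin_iff_scott_open)

text \<open>A directed supremum above \<open>x\<close> lies in the open set \<open>A\<close>, so
  some member of the directed set does too, and it is above the infimum of \<open>A\<close>.\<close>

lemma way_below_inf:
  assumes "openin X A" "x \<in> A"
  shows "way_below L (\<Sqinter>\<^bsub>L\<^esub> A) x"
  unfolding way_below_def
proof (intro allI impI)
  fix D assume D: "directed_in L D \<and> x \<sqsubseteq> \<Squnion>\<^bsub>L\<^esub> D"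
  then have "D \<subseteq> carrier L" by (simp add: directed_in_def)
  then have "\<Squnion>\<^bsub>L\<^esub> D \<in> A" using open_upper[OF assms] D sup_closed by blast
  then obtain d where "d \<in> D" "d \<in> A" using directed_sup_in_open D assms by blast
  then show "\<exists>d\<in>D. \<Sqinter>\<^bsub>L\<^esub> A \<sqsubseteq> d" using inf_lower[OF openin_carrier[OF assms(1)]] by blast
qed

lemma eq_sup_of_infs:
  "x \<in> carrier L \<Longrightarrow> x = \<Squnion>\<^bsub>L\<^esub> {\<Sqinter>\<^bsub>L\<^esub> A | A. openin X A \<and> x \<in> A}"
  using alpha_eq_sup_infs[OF open_filter_F_unit, of x] unit carrier_eq
  by (simp add: F_unit_def)

lemma continuous_lattice: "continuous_lattice L"
  unfolding continuous_lattice_def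
proof (intro conjI ballI)
  show "complete_lattice L" ..
  fix x assume x: "x \<in> carrier L"
  let ?W = "{y \<in> carrier L. way_below L y x}"
  let ?I = "{\<Sqinter>\<^bsub>L\<^esub> A | A. openin X A \<and> x \<in> A}"
  have I: "?I \<subseteq> ?W"
  proof clarify
    fix A assume A: "openin X A" "x \<in> A"
    show "\<Sqinter>\<^bsub>L\<^esub> A \<in> carrier L \<and> way_below L (\<Sqinter>\<^bsub>L\<^esub> A) x"
      using inf_closed[OF openin_carrier[OF A(1)]] way_below_inf[OF A] by (rule conjI)
  qed
  have W: "?W \<subseteq> carrier L" by blast
  have "\<Squnion>\<^bsub>L\<^esub> ?I \<sqsubseteq> \<Squnion>\<^bsub>L\<^esub> ?W"
    using I W by (intro sup_least sup_closed sup_upper[OF W]) blast+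
  then have le: "x \<sqsubseteq> \<Squnion>\<^bsub>L\<^esub> ?W" using eq_sup_of_infs[OF x] by simp
  have "y \<sqsubseteq> x" if "way_below L y x" for y
  proof -
    have "directed_in L {x}" "x \<sqsubseteq> \<Squnion>\<^bsub>L\<^esub> {x}" using x by (auto simp: directed_in_def)
    then show ?thesis using that unfolding way_below_def by blast
  qed
  then have "\<Squnion>\<^bsub>L\<^esub> ?W \<sqsubseteq> x" using sup_least[OF W x] by blast
  then show "x = \<Squnion>\<^bsub>L\<^esub> ?W" using le x sup_closed[OF W] le_antisym by blast
qed

text \<open>Associativity is automatic: \<open>\<alpha>\<^sup>-\<^sup>1[U] \<subseteq> U\<^sup>#\<close> for every open \<open>U\<close> gives one inequality,
  and \<open>A\<^sup># \<subseteq> \<alpha>\<^sup>-\<^sup>1[U]\<close> whenever \<open>\<Sqinter>A \<in> U\<close> gives the other.\<close>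

lemma assoc:
  assumes \<FF>: "open_filter (F_space X) \<FF>"
  shows "\<alpha> (F_map (F_space X) X \<alpha> \<FF>) = \<alpha> (F_mult X \<FF>)"
proof -
  let ?l = "F_map (F_space X) X \<alpha> \<FF>" and ?r = "F_mult X \<FF>"
  have l: "open_filter X ?l" by (rule open_filter_F_map[OF continuous \<FF>])
  have r: "open_filter X ?r"
    unfolding open_filter_def
  proof (intro conjI ballI allI impI)
    have "sharp X (topspace X) = topspace (F_space X)"
      using open_filter_topspace by (auto simp: sharp_def topspace_F_space)
    then show "topspace X \<in> ?r"
      using open_filter_topspace[OF \<FF>] by (simp add: F_mult_def)
    fix A assume A: "A \<in> ?r"
    then show "openin X A" by (simp add: F_mult_def)
    show "A \<inter> B \<in> ?r" if B: "B \<in> ?r" for B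
    proof -
      have "sharp X A \<inter> sharp X B = sharp X (A \<inter> B)"
        using A B by (auto simp: sharp_def F_mult_def intro: open_filter_Int open_filter_upper)
      then show ?thesis
        using A B open_filter_Int[OF \<FF>, of "sharp X A" "sharp X B"]
        by (simp add: F_mult_def openin_Int)
    qed
    show "B \<in> ?r" if "openin X B \<and> A \<subseteq> B" for B
      using that A open_filter_upper[OF \<FF>, of "sharp X A" "sharp X B"]
      by (simp add: F_mult_def sharp_mono openin_sharp)
  qed
  have pre: "openin (F_space X) {\<gg> \<in> topspace (F_space X). \<alpha> \<gg> \<in> U}" if "openin X U" for U
    using openin_continuous_map_preimage[OF continuous that] .
  have "?l \<subseteq> ?r"
  proof
    fix U assume "U \<in> ?l"
    then have U: "openin X U" and P: "{\<gg> \<in> topspace (F_space X). \<alpha> \<gg> \<in> U} \<in> \<FF>"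
      by (auto simp: F_map_def)
    have "\<gg> \<in> sharp X U" if "open_filter X \<gg>" "\<alpha> \<gg> \<in> U" for \<gg>
    proof -
      have "F_unit X (\<alpha> \<gg>) \<subseteq> \<gg>"
        using le_alpha_iff[OF that(1) alpha_closed[OF that(1)]] le_refl[OF alpha_closed[OF that(1)]]
        by simp
      then show ?thesis using that U by (auto simp: sharp_def F_unit_def)
    qed
    then have "{\<gg> \<in> topspace (F_space X). \<alpha> \<gg> \<in> U} \<subseteq> sharp X U"
      by (auto simp: topspace_F_space)
    then show "U \<in> ?r"
      using open_filter_upper[OF \<FF> P openin_sharp[OF U]] U by (simp add: F_mult_def)
  qed
  then have "\<alpha> ?l \<sqsubseteq> \<alpha> ?r" using alpha_mono l r by blast
  moreover have "\<alpha> ?r \<sqsubseteq> \<alpha> ?l"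
  proof (subst le_alpha_iff[OF l alpha_closed[OF r]], rule subsetI)
    fix U assume "U \<in> F_unit X (\<alpha> ?r)"
    then have U: "openin X U" "\<alpha> ?r \<in> U" by (simp_all add: F_unit_def)
    from inf_in_open[OF r U] obtain A where A: "A \<in> ?r" "\<Sqinter>\<^bsub>L\<^esub> A \<in> U" .
    have "\<alpha> \<gg> \<in> U" if "open_filter X \<gg>" "A \<in> \<gg>" for \<gg>
      using open_upper[OF U(1) A(2) alpha_closed[OF that(1)] inf_le_alpha[OF that]] .
    then have "sharp X A \<subseteq> {\<gg> \<in> topspace (F_space X). \<alpha> \<gg> \<in> U}"
      by (auto simp: sharp_def topspace_F_space)
    then show "U \<in> ?l"
      using A U open_filter_upper[OF \<FF> _ pre[OF U(1)], of "sharp X A"]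
      by (simp add: F_mult_def F_map_def)
  qed
  ultimately show ?thesis using le_antisym alpha_closed l r by blast
qed

lemma F_algebra: "F_algebra X \<alpha>"
proof -
  have "\<forall>x\<in>topspace X. \<alpha> (F_unit X x) = x"
    using unit carrier_eq by simp
  moreover have "\<forall>\<FF>\<in>topspace (F_space (F_space X)).
      \<alpha> (F_map (F_space X) X \<alpha> \<FF>) = \<alpha> (F_mult X \<FF>)"
    unfolding topspace_F_space using assoc by blast
  ultimately show ?thesis
    unfolding F_algebra_def by (intro conjI t0 continuous)
qed

end

section \<open>Specialisation orders of algebras\<close>

lemma specialization_spec_order:
  assumes X: "t0_space X"
  shows "specialization (spec_order X) X"
proof -
  have sel: "carrier (spec_order X) = topspace X" "eq (spec_order X) = (=)"
    and le: "\<And>x y. x \<sqsubseteq>\<^bsub>spec_order X\<^esub> y \<longleftrightarrow> (\<forall>U. openin X U \<longrightarrow> x \<in> U \<longrightarrow> y \<in> U)"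
    by (simp_all add: spec_order_def)
  have antisym: "x = y"
    if "x \<sqsubseteq>\<^bsub>spec_order X\<^esub> y" "y \<sqsubseteq>\<^bsub>spec_order X\<^esub> x" "x \<in> topspace X" "y \<in> topspace X" for x y
    using X[unfolded t0_space_def] that unfolding le by blast
  have trans: "x \<sqsubseteq>\<^bsub>spec_order X\<^esub> z"
    if "x \<sqsubseteq>\<^bsub>spec_order X\<^esub> y" "y \<sqsubseteq>\<^bsub>spec_order X\<^esub> z" for x y z
    using that unfolding le by blast
  have "equivalence (spec_order X)"
    by (rule equivalence.intro) (simp_all add: sel)
  moreover have "weak_partial_order_axioms (spec_order X)"
    by (rule weak_partial_order_axioms.intro)
      (simp_all only: sel antisym, simp add: le, erule (1) trans)
  ultimately have "partial_order (spec_order X)"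
    by (intro partial_order.intro weak_partial_order.intro partial_order_axioms.intro)
      (simp_all add: sel)
  then show ?thesis
    by (intro specialization.intro specialization_axioms.intro) (simp_all only: sel le)
qed

lemma kz_algebra_spec_order:
  assumes "F_algebra X \<alpha>"
  shows "kz_algebra (spec_order X) X \<alpha>"
proof (intro kz_algebra.intro kz_algebra_axioms.intro)
  show "specialization (spec_order X) X"
    using assms by (intro specialization_spec_order) (simp add: F_algebra_def)
  show "continuous_map (F_space X) X \<alpha>" using assms by (simp add: F_algebra_def)
  show "\<alpha> (F_unit X x) = x" if "x \<in> carrier (spec_order X)" for x
    using assms that by (simp add: F_algebra_def spec_order_def)
qed


section \<open>Continuous lattices are algebras\<close>

context gorder_complete_lattice
begin

lemma specialization_scott: "specialization L (scott_topology L)"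
proof unfold_locales
  show "carrier L = topspace (scott_topology L)" by (simp add: topspace_scott_topology)
  fix x y assume x: "x \<in> carrier L" and y: "y \<in> carrier L"
  \<comment> \<open>The complement of the principal down-set of \<open>y\<close>. It is Scott open
    because a directed set inside the down-set has its supremum there, and it separates
    \<open>x\<close> from \<open>y\<close> unless \<open>x \<sqsubseteq> y\<close>.\<close>
  let ?U = "{z \<in> carrier L. \<not> z \<sqsubseteq> y}"
  have "scott_open L ?U"
    unfolding scott_open_def
  proof (intro conjI ballI impI allI)
    show "w \<in> ?U" if "z \<in> ?U" "w \<in> carrier L" "z \<sqsubseteq> w" for z w
      using that le_trans[of z w y] y by blast
    show "D \<inter> ?U \<noteq> {}" if "directed_in L D \<and> \<Squnion>\<^bsub>L\<^esub> D \<in> ?U" for D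
      using that sup_least[of D y] y unfolding directed_in_def by blast
  qed blast
  then show "x \<sqsubseteq> y \<longleftrightarrow> (\<forall>U. openin (scott_topology L) U \<longrightarrow> x \<in> U \<longrightarrow> y \<in> U)"
    using scott_open_upper[of L _ x y] x y le_refl[OF y]
    unfolding openin_scott_topology by blast
qed

section \<open>The way-below relation and interpolation\<close>

lemma way_below_le_trans:
  assumes "way_below L x y" "y \<sqsubseteq> z" "y \<in> carrier L" "z \<in> carrier L"
  shows "way_below L x z"
  unfolding way_below_def
proof (intro allI impI)
  fix D assume D: "directed_in L D \<and> z \<sqsubseteq> \<Squnion>\<^bsub>L\<^esub> D"
  then have "D \<subseteq> carrier L" by (simp add: directed_in_def)
  then have "y \<sqsubseteq> \<Squnion>\<^bsub>L\<^esub> D" using D le_trans[OF assms(2)] assms(3,4) sup_closed by simp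
  then show "\<exists>d\<in>D. x \<sqsubseteq> d" using D assms(1) unfolding way_below_def by blast
qed

lemma le_way_below_trans:
  assumes "w \<sqsubseteq> x" "way_below L x y" "w \<in> carrier L" "x \<in> carrier L"
  shows "way_below L w y"
  unfolding way_below_def
proof (intro allI impI)
  fix D assume D: "directed_in L D \<and> y \<sqsubseteq> \<Squnion>\<^bsub>L\<^esub> D"
  then obtain d where "d \<in> D" "x \<sqsubseteq> d" using assms(2) unfolding way_below_def by blast
  then show "\<exists>d\<in>D. w \<sqsubseteq> d"
    using le_trans[OF assms(1), of d] assms(3,4) D unfolding directed_in_def by blast
qed

lemma way_below_imp_le:
  assumes "way_below L y x" "x \<in> carrier L"
  shows "y \<sqsubseteq> x"
proof -
  have "directed_in L {x}" "x \<sqsubseteq> \<Squnion>\<^bsub>L\<^esub> {x}" using assms by (auto simp: directed_in_def)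
  then show ?thesis using assms(1) unfolding way_below_def by blast
qed

lemma join_way_below:
  assumes "way_below L x z" "way_below L y z" "x \<in> carrier L" "y \<in> carrier L"
  shows "way_below L (x \<squnion> y) z"
  unfolding way_below_def
proof (intro allI impI)
  fix D assume D: "directed_in L D \<and> z \<sqsubseteq> \<Squnion>\<^bsub>L\<^esub> D"
  then obtain d e where de: "d \<in> D" "x \<sqsubseteq> d" "e \<in> D" "y \<sqsubseteq> e"
    using assms unfolding way_below_def by meson
  then obtain g where g: "g \<in> D" "d \<sqsubseteq> g" "e \<sqsubseteq> g" using D unfolding directed_in_def by meson
  have c: "d \<in> carrier L" "e \<in> carrier L" "g \<in> carrier L"
    using D de g unfolding directed_in_def by blast+
  have "x \<sqsubseteq> g" "y \<sqsubseteq> g"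
    using le_trans[OF de(2) g(2)] le_trans[OF de(4) g(3)] c assms(3,4) by simp_all
  then have "x \<squnion> y \<sqsubseteq> g" using join_le assms(3,4) c by simp
  then show "\<exists>d\<in>D. x \<squnion> y \<sqsubseteq> d" using g by blast
qed

lemma bottom_way_below: "way_below L \<bottom> x"
  unfolding way_below_def directed_in_def using bottom_lower by blast

text \<open>The elements way below some member of \<open>D\<close> again form a directed set with supremum \<open>\<Squnion>D\<close>.\<close>

lemma way_below_directed_sup:
  assumes L: "continuous_lattice L" and D: "directed_in L D"
    and y: "y \<in> carrier L" "way_below L y (\<Squnion>\<^bsub>L\<^esub> D)"
  shows "\<exists>d\<in>D. way_below L y d"
proof -
  have Dc: "D \<subseteq> carrier L" "D \<noteq> {}" using D by (simp_all add: directed_in_def)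
  define E where "E = {w \<in> carrier L. \<exists>d\<in>D. way_below L w d}"
  have Ec: "E \<subseteq> carrier L" by (auto simp: E_def)
  have "directed_in L E"
    unfolding directed_in_def
  proof (intro conjI ballI)
    show "E \<noteq> {}" using Dc bottom_way_below bottom_closed unfolding E_def by blast
    fix v w assume "v \<in> E" "w \<in> E"
    then obtain d e where vw: "v \<in> carrier L" "d \<in> D" "way_below L v d"
      "w \<in> carrier L" "e \<in> D" "way_below L w e" by (auto simp: E_def)
    then obtain g where g: "g \<in> D" "d \<sqsubseteq> g" "e \<sqsubseteq> g" using D unfolding directed_in_def by meson
    have c: "d \<in> carrier L" "e \<in> carrier L" "g \<in> carrier L" using Dc vw g by blast+
    have "way_below L (v \<squnion> w) g"
      using join_way_below way_below_le_trans[OF vw(3) g(2)] way_below_le_trans[OF vw(6) g(3)]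
        c vw by simp
    then have "v \<squnion> w \<in> E" using g join_closed vw unfolding E_def by blast
    then show "\<exists>z\<in>E. v \<sqsubseteq> z \<and> w \<sqsubseteq> z" using join_left join_right vw by blast
  qed (rule Ec)
  moreover have "\<Squnion>\<^bsub>L\<^esub> D \<sqsubseteq> \<Squnion>\<^bsub>L\<^esub> E"
  proof (rule sup_least[OF Dc(1) sup_closed[OF Ec]])
    fix d assume d: "d \<in> D"
    then have "d = \<Squnion>\<^bsub>L\<^esub> {w \<in> carrier L. way_below L w d}"
      using L Dc unfolding continuous_lattice_def by blast
    moreover have "\<Squnion>\<^bsub>L\<^esub> {w \<in> carrier L. way_below L w d} \<sqsubseteq> \<Squnion>\<^bsub>L\<^esub> E"
      by (rule sup_least) (use d Ec sup_upper[OF Ec] sup_closed[OF Ec] in \<open>auto simp: E_def\<close>)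
    ultimately show "d \<sqsubseteq> \<Squnion>\<^bsub>L\<^esub> E" by simp
  qed
  ultimately obtain w where w: "w \<in> E" "y \<sqsubseteq> w" using y(2) unfolding way_below_def by blast
  then obtain d where "d \<in> D" "way_below L w d" "w \<in> carrier L" by (auto simp: E_def)
  then show ?thesis using le_way_below_trans[OF w(2)] y(1) by blast
qed

text \<open>Inaccessibility is interpolation. For \<open>y\<close> way below \<open>x\<close> this
  set is an open neighbourhood of \<open>x\<close> whose infimum is at least
  \<open>y\<close>.\<close>

lemma scott_open_way_below:
  assumes "continuous_lattice L" "y \<in> carrier L"
  shows "scott_open L {z \<in> carrier L. way_below L y z}"
  unfolding scott_open_def
proof (intro conjI ballI impI allI)
  show "w \<in> {z \<in> carrier L. way_below L y z}"
    if "z \<in> {z \<in> carrier L. way_below L y z}" "w \<in> carrier L" "z \<sqsubseteq> w" for z w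
    using that way_below_le_trans[of y z w] by blast
  show "D \<inter> {z \<in> carrier L. way_below L y z} \<noteq> {}"
    if "directed_in L D \<and> \<Squnion>\<^bsub>L\<^esub> D \<in> {z \<in> carrier L. way_below L y z}" for D
    using that way_below_directed_sup[OF assms(1) _ assms(2), of D]
    by (auto simp: directed_in_def)
qed blast

text \<open>The formula is the only candidate on open filters, by \<open>alpha_eq_sup_infs\<close>.
  Continuity of the map rests on the inaccessibility of Scott opens; continuity of the lattice gives
  the unit law, through the open sets of elements that have a given \<open>y\<close> way below
  them.\<close>

lemma kz_algebra_scott:
  assumes L: "continuous_lattice L"
  shows "kz_algebra L (scott_topology L) (\<lambda>\<ff>. \<Squnion>\<^bsub>L\<^esub> {\<Sqinter>\<^bsub>L\<^esub> A | A. A \<in> \<ff>})"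
proof -
  let ?X = "scott_topology L" and ?\<alpha> = "\<lambda>\<ff>. \<Squnion>\<^bsub>L\<^esub> {\<Sqinter>\<^bsub>L\<^esub> A | A. A \<in> \<ff>}"
  interpret specialization L ?X by (rule specialization_scott)
  have Ac: "A \<subseteq> carrier L" if "open_filter ?X \<ff>" "A \<in> \<ff>" for \<ff> A
    using open_filter_subset[OF that] carrier_eq by simp
  have Ic: "{\<Sqinter>\<^bsub>L\<^esub> A | A. A \<in> \<ff>} \<subseteq> carrier L" if "open_filter ?X \<ff>" for \<ff>
    using inf_closed Ac[OF that] by blast
  have "continuous_map (F_space ?X) ?X ?\<alpha>"
    unfolding continuous_map_def
  proof (intro conjI allI impI)
    show "?\<alpha> \<in> topspace (F_space ?X) \<rightarrow> topspace ?X"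
      using sup_closed[OF Ic] carrier_eq by (simp add: topspace_F_space)
    fix U assume U: "openin ?X U"
    show "openin (F_space ?X) {\<ff> \<in> topspace (F_space ?X). ?\<alpha> \<ff> \<in> U}"
    proof (rule openin_F_spaceI)
      show "{\<ff> \<in> topspace (F_space ?X). ?\<alpha> \<ff> \<in> U} \<subseteq> {\<ff>. open_filter ?X \<ff>}"
        by (auto simp: topspace_F_space)
      fix \<ff> assume "\<ff> \<in> {\<ff> \<in> topspace (F_space ?X). ?\<alpha> \<ff> \<in> U}"
      then have \<ff>: "open_filter ?X \<ff>" "?\<alpha> \<ff> \<in> U" by (simp_all add: topspace_F_space)
      then obtain A where A: "A \<in> \<ff>" "\<Sqinter>\<^bsub>L\<^esub> A \<in> U"
        using scott_open_inaccessible[OF _ directed_infs[OF carrier_eq \<ff>(1)]] U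
        unfolding openin_scott_topology by blast
      have "?\<alpha> \<gg> \<in> U" if \<gg>: "open_filter ?X \<gg>" "A \<in> \<gg>" for \<gg>
      proof -
        have "\<Sqinter>\<^bsub>L\<^esub> A \<sqsubseteq> ?\<alpha> \<gg>" using sup_upper[OF Ic[OF \<gg>(1)]] \<gg>(2) by blast
        then show ?thesis using open_upper[OF U A(2)] sup_closed[OF Ic[OF \<gg>(1)]] by simp
      qed
      then show "\<exists>A\<in>\<ff>. sharp ?X A \<subseteq> {\<ff> \<in> topspace (F_space ?X). ?\<alpha> \<ff> \<in> U}"
        using A(1) by (auto simp: sharp_def topspace_F_space)
    qed
  qed
  moreover have "?\<alpha> (F_unit ?X x) = x" if x: "x \<in> carrier L" for x
  proof -
    have \<ff>: "open_filter ?X (F_unit ?X x)" using open_filter_F_unit x carrier_eq by simp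
    note Ic = Ic[OF \<ff>]
    have "?\<alpha> (F_unit ?X x) \<sqsubseteq> x"
    proof (rule sup_least[OF Ic x])
      fix a assume "a \<in> {\<Sqinter>\<^bsub>L\<^esub> A | A. A \<in> F_unit ?X x}"
      then show "a \<sqsubseteq> x" using inf_lower Ac[OF \<ff>] by (auto simp: F_unit_def)
    qed
    moreover have "x \<sqsubseteq> ?\<alpha> (F_unit ?X x)"
    proof -
      have "\<Squnion>\<^bsub>L\<^esub> {y \<in> carrier L. way_below L y x} \<sqsubseteq> ?\<alpha> (F_unit ?X x)"
      proof (rule sup_least[OF _ sup_closed[OF Ic]])
        fix y assume y: "y \<in> {y \<in> carrier L. way_below L y x}"
        let ?A = "{z \<in> carrier L. way_below L y z}"
        have A: "?A \<in> F_unit ?X x"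
          using scott_open_way_below[OF L] x y by (simp add: F_unit_def openin_scott_topology)
        have le: "y \<sqsubseteq> \<Sqinter>\<^bsub>L\<^esub> ?A"
          by (rule inf_greatest) (use y way_below_imp_le in auto)
        have "\<Sqinter>\<^bsub>L\<^esub> ?A \<in> {\<Sqinter>\<^bsub>L\<^esub> A | A. A \<in> F_unit ?X x}" using A by blast
        then show "y \<sqsubseteq> ?\<alpha> (F_unit ?X x)"
          using le_trans[OF le sup_upper[OF Ic]] y inf_closed[OF Ac[OF \<ff> A]] sup_closed[OF Ic]
          by simp
      qed blast
      moreover have "x = \<Squnion>\<^bsub>L\<^esub> {y \<in> carrier L. way_below L y x}"
        using L x unfolding continuous_lattice_def by blast
      ultimately show ?thesis by simp
    qed
    ultimately show ?thesis using le_antisym x sup_closed[OF Ic] by simp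
  qed
  ultimately show ?thesis
    by (intro kz_algebra.intro kz_algebra_axioms.intro specialization_scott)
qed

end


section \<open>Homomorphisms\<close>

text \<open>Both topologies are Scott topologies, so continuity amounts to preservation of directed
  suprema. At principal filters, which \<open>F_map\<close> sends to principal filters of images,
  the algebra equation is preservation of infima; it extends to all filters because the structure
  maps are computed from infima of members.\<close>

lemma F_hom_iff_ContLat_hom:
  assumes "kz_algebra L X \<alpha>" "kz_algebra M Y \<beta>"
  shows "F_hom X \<alpha> Y \<beta> f \<longleftrightarrow> ContLat_hom L M f"
proof
  interpret L: kz_algebra L X \<alpha> by fact
  interpret M: kz_algebra M Y \<beta> by fact
  assume hom: "F_hom X \<alpha> Y \<beta> f"
  then have cont: "continuous_map X Y f" by (simp add: F_hom_def)
  have maps: "f \<in> carrier L \<rightarrow> carrier M"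
    using continuous_map_funspace[OF cont] L.carrier_eq M.carrier_eq by simp
  have pre: "openin X {x \<in> topspace X. f x \<in> V}" if "openin Y V" for V
    using openin_continuous_map_preimage[OF cont that] .
  have mono: "f x \<sqsubseteq>\<^bsub>M\<^esub> f y" if xy: "x \<in> carrier L" "y \<in> carrier L" "x \<sqsubseteq>\<^bsub>L\<^esub> y" for x y
  proof -
    have "f y \<in> V" if V: "openin Y V" "f x \<in> V" for V
      using L.open_upper[OF pre[OF V(1)] _ xy(2,3)] xy(1) V(2) L.carrier_eq by simp
    then show ?thesis using M.le_iff funcset_mem[OF maps] xy by simp
  qed
  have "f (\<Squnion>\<^bsub>L\<^esub> D) = \<Squnion>\<^bsub>M\<^esub> (f ` D)" if D: "directed_in L D" for D
  proof -
    have Dc: "D \<subseteq> carrier L" using D by (simp add: directed_in_def)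
    have fD: "f ` D \<subseteq> carrier M" using Dc maps by blast
    have sc: "\<Squnion>\<^bsub>L\<^esub> D \<in> carrier L" using L.sup_closed[OF Dc] .
    have fsc: "f (\<Squnion>\<^bsub>L\<^esub> D) \<in> carrier M" using funcset_mem[OF maps sc] .
    have "\<Squnion>\<^bsub>M\<^esub> (f ` D) \<in> V" if V: "openin Y V" "f (\<Squnion>\<^bsub>L\<^esub> D) \<in> V" for V
    proof -
      obtain d where d: "d \<in> D" "f d \<in> V"
        using L.directed_sup_in_open[OF D pre[OF V(1)]] V(2) sc L.carrier_eq by auto
      then have "f d \<sqsubseteq>\<^bsub>M\<^esub> \<Squnion>\<^bsub>M\<^esub> (f ` D)" using M.sup_upper[OF fD] by blast
      then show ?thesis using M.open_upper[OF V(1) d(2) M.sup_closed[OF fD]] by simp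
    qed
    then have "f (\<Squnion>\<^bsub>L\<^esub> D) \<sqsubseteq>\<^bsub>M\<^esub> \<Squnion>\<^bsub>M\<^esub> (f ` D)"
      using M.le_iff[OF fsc M.sup_closed[OF fD]] by simp
    moreover have "\<Squnion>\<^bsub>M\<^esub> (f ` D) \<sqsubseteq>\<^bsub>M\<^esub> f (\<Squnion>\<^bsub>L\<^esub> D)"
    proof (rule M.sup_least[OF fD fsc])
      fix z assume "z \<in> f ` D"
      then obtain d where d: "d \<in> D" "z = f d" by blast
      then show "z \<sqsubseteq>\<^bsub>M\<^esub> f (\<Squnion>\<^bsub>L\<^esub> D)"
        using mono[OF _ sc L.sup_upper[OF Dc d(1)]] Dc by blast
    qed
    ultimately show ?thesis using M.le_antisym fsc M.sup_closed[OF fD] by simp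
  qed
  moreover have "f (\<Sqinter>\<^bsub>L\<^esub> S) = \<Sqinter>\<^bsub>M\<^esub> (f ` S)" if S: "S \<subseteq> carrier L" for S
  proof -
    have fS: "f ` S \<subseteq> carrier M" using S maps by blast
    have "open_filter X (open_supersets X S)"
      using open_filter_open_supersets S L.carrier_eq by simp
    then have "f (\<alpha> (open_supersets X S)) = \<beta> (F_map X Y f (open_supersets X S))"
      using hom by (simp add: F_hom_def topspace_F_space)
    moreover have "F_map X Y f (open_supersets X S) = open_supersets Y (f ` S)"
      using pre S L.carrier_eq by (auto simp: F_map_def open_supersets_def)
    ultimately show ?thesis
      using L.inf_eq_alpha[OF S] M.inf_eq_alpha[OF fS] by simp
  qed
  ultimately show "ContLat_hom L M f" using maps unfolding ContLat_hom_def by blast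
next
  interpret L: kz_algebra L X \<alpha> by fact
  interpret M: kz_algebra M Y \<beta> by fact
  assume hom: "ContLat_hom L M f"
  have maps: "f \<in> carrier L \<rightarrow> carrier M"
    and dir: "\<And>D. directed_in L D \<Longrightarrow> f (\<Squnion>\<^bsub>L\<^esub> D) = \<Squnion>\<^bsub>M\<^esub> (f ` D)"
    and inf: "\<And>S. S \<subseteq> carrier L \<Longrightarrow> f (\<Sqinter>\<^bsub>L\<^esub> S) = \<Sqinter>\<^bsub>M\<^esub> (f ` S)"
    using hom by (simp_all add: ContLat_hom_def)
  \<comment> \<open>Monotonicity is extracted from the infimum of a two-element set; it is needed to
    see that images of directed sets are directed.\<close>
  have mono: "f x \<sqsubseteq>\<^bsub>M\<^esub> f y" if xy: "x \<in> carrier L" "y \<in> carrier L" "x \<sqsubseteq>\<^bsub>L\<^esub> y" for x y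
  proof -
    have "f (\<Sqinter>\<^bsub>L\<^esub> {x, y}) = \<Sqinter>\<^bsub>M\<^esub> {f x, f y}" using inf[of "{x, y}"] xy by simp
    moreover have "\<Sqinter>\<^bsub>L\<^esub> {x, y} = x"
      using L.le_iff_join[of x y] xy by (simp add: meet_def)
    moreover have "\<Sqinter>\<^bsub>M\<^esub> {f x, f y} \<sqsubseteq>\<^bsub>M\<^esub> f y"
      using M.inf_lower[of "{f x, f y}" "f y"] funcset_mem[OF maps] xy by simp
    ultimately show ?thesis by simp
  qed
  have pre: "openin X {x \<in> carrier L. f x \<in> V}" if V: "openin Y V" for V
    unfolding L.openin_iff_scott_open scott_open_def
  proof (intro conjI ballI allI impI)
    show "y \<in> {x \<in> carrier L. f x \<in> V}"
      if "x \<in> {x \<in> carrier L. f x \<in> V}" "y \<in> carrier L" "x \<sqsubseteq>\<^bsub>L\<^esub> y" for x y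
      using that M.open_upper[OF V _ funcset_mem[OF maps that(2)] mono[OF _ that(2,3)]] by simp
    show "D \<inter> {x \<in> carrier L. f x \<in> V} \<noteq> {}"
      if D: "directed_in L D \<and> \<Squnion>\<^bsub>L\<^esub> D \<in> {x \<in> carrier L. f x \<in> V}" for D
    proof -
      have Dc: "D \<subseteq> carrier L" "D \<noteq> {}" using D by (simp_all add: directed_in_def)
      have "directed_in M (f ` D)"
        unfolding directed_in_def
      proof (intro conjI ballI)
        show "f ` D \<subseteq> carrier M" using Dc maps by blast
        show "f ` D \<noteq> {}" using Dc by simp
        fix u v assume "u \<in> f ` D" "v \<in> f ` D"
        then obtain d e where de: "d \<in> D" "u = f d" "e \<in> D" "v = f e" by blast
        then obtain g where g: "g \<in> D" "d \<sqsubseteq>\<^bsub>L\<^esub> g" "e \<sqsubseteq>\<^bsub>L\<^esub> g"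
          using D unfolding directed_in_def by meson
        then have "u \<sqsubseteq>\<^bsub>M\<^esub> f g" "v \<sqsubseteq>\<^bsub>M\<^esub> f g" using mono de subsetD[OF Dc(1)] by simp_all
        then show "\<exists>z\<in>f ` D. u \<sqsubseteq>\<^bsub>M\<^esub> z \<and> v \<sqsubseteq>\<^bsub>M\<^esub> z" using g(1) by (intro bexI[of _ "f g"]) simp_all
      qed
      moreover have "\<Squnion>\<^bsub>M\<^esub> (f ` D) \<in> V" using D dir[of D] by simp
      ultimately have "\<exists>d\<in>f ` D. d \<in> V" using V by (intro M.directed_sup_in_open)
      then show ?thesis using Dc by auto
    qed
  qed blast
  have cont: "continuous_map X Y f"
    unfolding continuous_map_def
    using maps pre L.carrier_eq M.carrier_eq by simp
  moreover have "f (\<alpha> \<ff>) = \<beta> (F_map X Y f \<ff>)" if \<ff>: "open_filter X \<ff>" for \<ff>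
  proof -
    have F: "open_filter Y (F_map X Y f \<ff>)" using open_filter_F_map[OF cont \<ff>] .
    have ac: "\<alpha> \<ff> \<in> carrier L" using L.alpha_closed[OF \<ff>] .
    have fac: "f (\<alpha> \<ff>) \<in> carrier M" using funcset_mem[OF maps ac] .
    \<comment> \<open>If the preimage \<open>A\<close> of an open \<open>B\<close> belongs to
      \<open>\<ff>\<close>, the infimum of \<open>B\<close> is below that of the image of
      \<open>A\<close>, which \<open>f\<close> obtains from the infimum of \<open>A\<close>, and
      this in turn lies below \<open>\<alpha> \<ff>\<close>.\<close>
    have "\<beta> (F_map X Y f \<ff>) \<sqsubseteq>\<^bsub>M\<^esub> f (\<alpha> \<ff>)"
      unfolding M.alpha_eq_sup_infs[OF F]
    proof (rule M.sup_least[OF _ fac])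
      show "{\<Sqinter>\<^bsub>M\<^esub> B | B. B \<in> F_map X Y f \<ff>} \<subseteq> carrier M"
        using M.open_filter_inf_closed[OF F] by auto
      fix z assume "z \<in> {\<Sqinter>\<^bsub>M\<^esub> B | B. B \<in> F_map X Y f \<ff>}"
      then obtain B where B: "z = \<Sqinter>\<^bsub>M\<^esub> B" "openin Y B" "{x \<in> topspace X. f x \<in> B} \<in> \<ff>"
        by (auto simp: F_map_def)
      let ?A = "{x \<in> topspace X. f x \<in> B}"
      have A: "?A \<subseteq> carrier L" using L.carrier_eq by auto
      have Bc: "B \<subseteq> carrier M" using M.openin_carrier[OF B(2)] .
      have fA: "f ` ?A \<subseteq> carrier M" using maps A by blast
      have "z \<sqsubseteq>\<^bsub>M\<^esub> \<Sqinter>\<^bsub>M\<^esub> (f ` ?A)"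
        unfolding B(1) using M.inf_lower[OF Bc]
        by (intro M.inf_greatest[OF fA M.inf_closed[OF Bc]]) auto
      then have 1: "z \<sqsubseteq>\<^bsub>M\<^esub> f (\<Sqinter>\<^bsub>L\<^esub> ?A)" using inf[OF A] by simp
      have 2: "f (\<Sqinter>\<^bsub>L\<^esub> ?A) \<sqsubseteq>\<^bsub>M\<^esub> f (\<alpha> \<ff>)"
        using mono[OF L.inf_closed[OF A] ac L.inf_le_alpha[OF \<ff> B(3)]] .
      show "z \<sqsubseteq>\<^bsub>M\<^esub> f (\<alpha> \<ff>)"
        using M.le_trans[OF 1 2] M.inf_closed[OF Bc] B(1) funcset_mem[OF maps L.inf_closed[OF A]] fac
        by simp
    qed
    moreover have "f (\<alpha> \<ff>) \<sqsubseteq>\<^bsub>M\<^esub> \<beta> (F_map X Y f \<ff>)"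
    proof (subst M.le_alpha_iff[OF F fac], rule subsetI)
      fix V assume "V \<in> F_unit Y (f (\<alpha> \<ff>))"
      then have V: "openin Y V" "f (\<alpha> \<ff>) \<in> V" by (simp_all add: F_unit_def)
      then have "{x \<in> carrier L. f x \<in> V} \<in> F_unit X (\<alpha> \<ff>)"
        using pre ac by (simp add: F_unit_def)
      moreover have "F_unit X (\<alpha> \<ff>) \<subseteq> \<ff>"
        using L.le_alpha_iff[OF \<ff> ac] L.le_refl[OF ac] by simp
      ultimately show "V \<in> F_map X Y f \<ff>"
        using V(1) L.carrier_eq by (simp add: F_map_def subset_iff)
    qed
    ultimately show ?thesis using M.le_antisym fac M.alpha_closed[OF F] by simp
  qed
  ultimately show "F_hom X \<alpha> Y \<beta> f" by (simp add: F_hom_def topspace_F_space)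
qed


section \<open>Compact elements\<close>

context gorder_complete_lattice
begin

lemma compacts_subset: "compacts L \<subseteq> carrier L"
  by (auto simp: compacts_def)

lemma compact_iff_way_below: "c \<in> compacts L \<longleftrightarrow> c \<in> carrier L \<and> way_below L c c"
  by (simp add: compacts_def way_below_def)

lemma bottom_compact: "\<bottom> \<in> compacts L"
  by (simp add: compact_iff_way_below bottom_way_below)

lemma join_compact:
  assumes "a \<in> compacts L" "b \<in> compacts L"
  shows "a \<squnion> b \<in> compacts L"
proof -
  have ab: "a \<in> carrier L" "b \<in> carrier L" "way_below L a a" "way_below L b b"
    using assms by (simp_all add: compact_iff_way_below)
  have "way_below L a (a \<squnion> b)" "way_below L b (a \<squnion> b)"
    using way_below_le_trans[OF ab(3) join_left] way_below_le_trans[OF ab(4) join_right] ab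
    by simp_all
  then show ?thesis using join_way_below ab by (simp add: compact_iff_way_below)
qed

section \<open>The subposet of compact elements\<close>

lemma compact_poset_simps:
  "carrier (compact_poset L) = compacts L"
  "x \<sqsubseteq>\<^bsub>compact_poset L\<^esub> y \<longleftrightarrow> x \<sqsubseteq> y"
  "eq (compact_poset L) = (=)"
  by (simp_all add: compact_poset_def eq_is_equal)

lemma partial_order_compact_poset: "partial_order (compact_poset L)"
proof -
  have "weak_partial_order (compact_poset L)"
    unfolding compact_poset_def by (rule weak_partial_order_subset[OF _ compacts_subset]) unfold_locales
  then show ?thesis
    by (intro partial_order.intro partial_order_axioms.intro) (simp_all add: compact_poset_simps)
qed

lemma compact_poset_glb_iff:
  assumes "S \<subseteq> compacts L"
  shows "is_glb (compact_poset L) g S \<longleftrightarrow>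
    g \<in> compacts L \<and> (\<forall>s\<in>S. g \<sqsubseteq> s) \<and> (\<forall>c\<in>compacts L. (\<forall>s\<in>S. c \<sqsubseteq> s) \<longrightarrow> c \<sqsubseteq> g)"
  using assms unfolding greatest_def Lower_def compact_poset_simps by blast

lemma compact_poset_lub_iff:
  assumes "S \<subseteq> compacts L"
  shows "is_lub (compact_poset L) g S \<longleftrightarrow>
    g \<in> compacts L \<and> (\<forall>s\<in>S. s \<sqsubseteq> g) \<and> (\<forall>c\<in>compacts L. (\<forall>s\<in>S. s \<sqsubseteq> c) \<longrightarrow> g \<sqsubseteq> c)"
  using assms unfolding least_def Upper_def compact_poset_simps by blast

lemma inf_compact_poset:
  assumes S: "S \<subseteq> compacts L" and c: "\<Sqinter>\<^bsub>L\<^esub> S \<in> compacts L"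
  shows "\<Sqinter>\<^bsub>compact_poset L\<^esub> S = \<Sqinter>\<^bsub>L\<^esub> S"
proof -
  interpret K: partial_order "compact_poset L" by (rule partial_order_compact_poset)
  have Sc: "S \<subseteq> carrier L" using S compacts_subset by (rule subset_trans)
  have "is_glb (compact_poset L) (\<Sqinter>\<^bsub>L\<^esub> S) S"
    unfolding compact_poset_glb_iff[OF S]
    using c inf_lower[OF Sc] inf_greatest[OF Sc] compacts_subset by blast
  \<comment> \<open>The infimum operation is a Hilbert choice of a greatest lower bound, so one
    witness makes the chosen value a greatest lower bound, and uniqueness identifies the
    two.\<close>
  then have "is_glb (compact_poset L) (\<Sqinter>\<^bsub>compact_poset L\<^esub> S) S"
    unfolding inf_def by (rule someI)
  then show ?thesis
    using K.weak_greatest_unique[OF _ \<open>is_glb (compact_poset L) (\<Sqinter>\<^bsub>L\<^esub> S) S\<close>]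
    by (simp add: compact_poset_simps)
qed

lemma join_compact_poset:
  assumes "a \<in> compacts L" "b \<in> compacts L"
  shows "a \<squnion>\<^bsub>compact_poset L\<^esub> b = a \<squnion> b"
proof -
  interpret K: partial_order "compact_poset L" by (rule partial_order_compact_poset)
  have ab: "a \<in> carrier L" "b \<in> carrier L" using assms compacts_subset by (auto dest: subsetD)
  have S: "{a, b} \<subseteq> compacts L" using assms by simp
  have lub: "is_lub (compact_poset L) (a \<squnion> b) {a, b}"
    unfolding compact_poset_lub_iff[OF S]
    using join_compact[OF assms] join_left[OF ab] join_right[OF ab] join_le[OF _ _ ab]
      compacts_subset by blast
  then have "is_lub (compact_poset L) (a \<squnion>\<^bsub>compact_poset L\<^esub> b) {a, b}"
    unfolding join_def[of "compact_poset L"] sup_def by (rule someI)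
  then show ?thesis
    using K.weak_least_unique[OF _ lub] by (simp add: compact_poset_simps)
qed

text \<open>Suprema come for free from infima: the least upper bound of \<open>A\<close> is the
  greatest lower bound of its compact upper bounds.\<close>

lemma complete_lattice_dual_compact_poset_iff:
  "complete_lattice (inv_gorder (compact_poset L)) \<longleftrightarrow>
    (\<forall>S\<subseteq>compacts L. \<exists>g. is_glb (compact_poset L) g S)"
proof
  assume "complete_lattice (inv_gorder (compact_poset L))"
  then interpret K: complete_lattice "inv_gorder (compact_poset L)" .
  show "\<forall>S\<subseteq>compacts L. \<exists>g. is_glb (compact_poset L) g S"
  proof (intro allI impI)
    fix S assume "S \<subseteq> compacts L"
    then have "S \<subseteq> carrier (inv_gorder (compact_poset L))" by (simp add: compact_poset_simps)
    from K.sup_exists[OF this] show "\<exists>g. is_glb (compact_poset L) g S"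
      unfolding Upper_dual least_dual .
  qed
next
  assume glb: "\<forall>S\<subseteq>compacts L. \<exists>g. is_glb (compact_poset L) g S"
  interpret K: partial_order "inv_gorder (compact_poset L)"
    by (rule partial_order.dual_order[OF partial_order_compact_poset])
  show "complete_lattice (inv_gorder (compact_poset L))"
  proof (rule K.complete_latticeI)
    fix A assume "A \<subseteq> carrier (inv_gorder (compact_poset L))"
    then have A: "A \<subseteq> compacts L" by (simp add: compact_poset_simps)
    show "\<exists>s. is_lub (inv_gorder (compact_poset L)) s A"
      unfolding Upper_dual least_dual using glb A by simp
    let ?U = "{u \<in> compacts L. \<forall>a\<in>A. a \<sqsubseteq> u}"
    obtain g where "is_glb (compact_poset L) g ?U"
      using glb[rule_format, OF Collect_subset] by (rule exE)
    then have g: "g \<in> compacts L" "\<And>u. u \<in> ?U \<Longrightarrow> g \<sqsubseteq> u"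
      "\<And>c. c \<in> compacts L \<Longrightarrow> (\<forall>u\<in>?U. c \<sqsubseteq> u) \<Longrightarrow> c \<sqsubseteq> g"
      unfolding compact_poset_glb_iff[OF Collect_subset] by simp_all
    have "a \<sqsubseteq> g" if "a \<in> A" for a using g(3)[of a] that A by blast
    then have "is_lub (compact_poset L) g A"
      unfolding compact_poset_lub_iff[OF A] using g(1,2) by simp
    then show "\<exists>s. is_glb (inv_gorder (compact_poset L)) s A"
      unfolding Lower_dual greatest_dual by (rule exI)
  qed
qed

lemma dual_of_frame_compact_poset_iff:
  "dual_of_frame (compact_poset L) \<longleftrightarrow>
    (\<forall>S\<subseteq>compacts L. \<exists>g. is_glb (compact_poset L) g S) \<and>
    (\<forall>a\<in>compacts L. \<forall>S\<subseteq>compacts L.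
      a \<squnion>\<^bsub>compact_poset L\<^esub> \<Sqinter>\<^bsub>compact_poset L\<^esub> S =
      \<Sqinter>\<^bsub>compact_poset L\<^esub> ((\<lambda>s. a \<squnion>\<^bsub>compact_poset L\<^esub> s) ` S))"
  unfolding dual_of_frame_def frame_def complete_lattice_dual_compact_poset_iff
    sup_dual meet_dual by (simp add: compact_poset_simps)

text \<open>Compactness of \<open>c\<close> is precisely inaccessibility of its up-set. Together
  with \<open>inf_above\<close> this presents every compact element as the infimum of an open
  set.\<close>

lemma scott_open_above_compact:
  assumes c: "c \<in> compacts L"
  shows "scott_open L {y \<in> carrier L. c \<sqsubseteq> y}"
  unfolding scott_open_def
proof (intro conjI ballI allI impI)
  have cc: "c \<in> carrier L" using c compacts_subset by blast
  show "z \<in> {y \<in> carrier L. c \<sqsubseteq> y}"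
    if "y \<in> {y \<in> carrier L. c \<sqsubseteq> y}" "z \<in> carrier L" "y \<sqsubseteq> z" for y z
    using that le_trans[of c y z] cc by simp
  show "D \<inter> {y \<in> carrier L. c \<sqsubseteq> y} \<noteq> {}"
    if "directed_in L D \<and> \<Squnion>\<^bsub>L\<^esub> D \<in> {y \<in> carrier L. c \<sqsubseteq> y}" for D
  proof -
    have "\<exists>d\<in>D. c \<sqsubseteq> d" using that c unfolding compacts_def by blast
    then show ?thesis using that unfolding directed_in_def by blast
  qed
qed blast

lemma inf_above:
  assumes "c \<in> carrier L"
  shows "\<Sqinter>\<^bsub>L\<^esub> {y \<in> carrier L. c \<sqsubseteq> y} = c"
proof -
  have s: "{y \<in> carrier L. c \<sqsubseteq> y} \<subseteq> carrier L" by blast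
  have "\<Sqinter>\<^bsub>L\<^esub> {y \<in> carrier L. c \<sqsubseteq> y} \<sqsubseteq> c" using inf_lower[OF s] assms by simp
  moreover have "c \<sqsubseteq> \<Sqinter>\<^bsub>L\<^esub> {y \<in> carrier L. c \<sqsubseteq> y}" using inf_greatest[OF s assms] by simp
  ultimately show ?thesis using le_antisym inf_closed[OF s] assms by simp
qed

lemma inf_antimono:
  assumes "A \<subseteq> B" "B \<subseteq> carrier L"
  shows "\<Sqinter>\<^bsub>L\<^esub> B \<sqsubseteq> \<Sqinter>\<^bsub>L\<^esub> A"
  using assms inf_lower[OF assms(2)] inf_closed[OF assms(2)]
  by (intro inf_greatest) auto

lemma algebraic_imp_continuous_lattice:
  assumes "algebraic_lattice L"
  shows "continuous_lattice L"
  unfolding continuous_lattice_def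
proof (intro conjI ballI)
  show "complete_lattice L" ..
  fix x assume x: "x \<in> carrier L"
  let ?K = "{c \<in> compacts L. c \<sqsubseteq> x}" and ?W = "{y \<in> carrier L. way_below L y x}"
  have W: "?W \<subseteq> carrier L" by blast
  have "?K \<subseteq> ?W"
    using way_below_le_trans[OF _ _ _ x] by (auto simp: compact_iff_way_below)
  then have "\<Squnion>\<^bsub>L\<^esub> ?K \<sqsubseteq> \<Squnion>\<^bsub>L\<^esub> ?W"
    using sup_upper[OF W] sup_closed[OF W] by (intro sup_least) auto
  moreover have "x = \<Squnion>\<^bsub>L\<^esub> ?K" using assms x unfolding algebraic_lattice_def by blast
  moreover have "\<Squnion>\<^bsub>L\<^esub> ?W \<sqsubseteq> x"
    by (rule sup_least[OF W x]) (use way_below_imp_le[OF _ x] in blast)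
  ultimately show "x = \<Squnion>\<^bsub>L\<^esub> ?W" using le_antisym[of x "\<Squnion>\<^bsub>L\<^esub> ?W"] x sup_closed[OF W] by simp
qed

end


section \<open>Split algebras\<close>

context kz_algebra
begin

definition "open_infs_compact \<longleftrightarrow> (\<forall>U. openin X U \<longrightarrow> \<Sqinter>\<^bsub>L\<^esub> U \<in> compacts L)"

text \<open>Only the inequality with content is recorded; the opposite one holds because infima are
  antitone.\<close>

definition "open_infs_join \<longleftrightarrow>
  (\<forall>U V. openin X U \<longrightarrow> openin X V \<longrightarrow> \<Sqinter>\<^bsub>L\<^esub> (U \<inter> V) \<sqsubseteq> \<Sqinter>\<^bsub>L\<^esub> U \<squnion> \<Sqinter>\<^bsub>L\<^esub> V)"

lemma le_spec_order_iff:
  "x \<in> carrier L \<Longrightarrow> y \<in> carrier L \<Longrightarrow> x \<sqsubseteq>\<^bsub>spec_order X\<^esub> y \<longleftrightarrow> x \<sqsubseteq> y"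
  using le_iff by (simp add: spec_order_def)

text \<open>Since \<open>\<alpha>\<close> sends the principal filter of \<open>U\<close> to \<open>\<Sqinter>U\<close>, the adjunction forces
  \<open>U \<in> t x\<close> to mean \<open>\<Sqinter>U \<sqsubseteq> x\<close>. Continuity of \<open>t\<close> is compactness of the infima \<open>\<Sqinter>U\<close>;
  closure of \<open>t x\<close> under intersection is the join condition.\<close>

lemma split_imp_open_infs:
  assumes t: "top_adjunction (F_space X) X \<alpha> t"
  shows "open_infs_compact" "open_infs_join"
proof -
  have ct: "continuous_map X (F_space X) t" using t by (simp add: top_adjunction_def)
  have tf: "open_filter X (t x)" if "x \<in> carrier L" for x
    using continuous_map_funspace[OF ct] that carrier_eq by (auto simp: topspace_F_space)
  have unit_t: "\<ff> \<subseteq> t (\<alpha> \<ff>)" if "open_filter X \<ff>" for \<ff>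
    using t le_F_space_iff[OF that tf[OF alpha_closed[OF that]]] that
    by (simp add: top_adjunction_def topspace_F_space)
  have counit_t: "\<alpha> (t x) \<sqsubseteq> x" if "x \<in> carrier L" for x
    using t le_spec_order_iff[OF alpha_closed[OF tf[OF that]] that] that carrier_eq
    by (simp add: top_adjunction_def)
  have pre: "openin X {x \<in> carrier L. U \<in> t x}" if U: "openin X U" for U
  proof -
    have "{x \<in> topspace X. t x \<in> sharp X U} = {x \<in> carrier L. U \<in> t x}"
      using tf carrier_eq by (auto simp: sharp_def)
    then show ?thesis
      using openin_continuous_map_preimage[OF ct openin_sharp[OF U]] by simp
  qed
  have t_iff: "U \<in> t x \<longleftrightarrow> \<Sqinter>\<^bsub>L\<^esub> U \<sqsubseteq> x" if U: "openin X U" and x: "x \<in> carrier L" for U x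
  proof
    have Uc: "U \<subseteq> carrier L" using openin_carrier[OF U] .
    show "\<Sqinter>\<^bsub>L\<^esub> U \<sqsubseteq> x" if "U \<in> t x"
      using le_trans[OF inf_le_alpha[OF tf[OF x] that] counit_t[OF x]] inf_closed[OF Uc]
        alpha_closed[OF tf[OF x]] x by simp
    have flt: "open_filter X (open_supersets X U)"
      using open_filter_open_supersets Uc carrier_eq by simp
    have "U \<in> open_supersets X U" using U by (simp add: open_supersets_def)
    \<comment> \<open>The unit of the adjunction at the principal filter of \<open>U\<close>. The
      set of all \<open>x\<close> with \<open>U \<in> t x\<close> is open, hence an upper set, so
      membership spreads to everything above the infimum of \<open>U\<close>.\<close>
    then have "U \<in> t (\<Sqinter>\<^bsub>L\<^esub> U)" using unit_t[OF flt] inf_eq_alpha[OF Uc] by auto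
    then have mem: "\<Sqinter>\<^bsub>L\<^esub> U \<in> {x \<in> carrier L. U \<in> t x}" using inf_closed[OF Uc] by simp
    show "U \<in> t x" if "\<Sqinter>\<^bsub>L\<^esub> U \<sqsubseteq> x"
      using open_upper[OF pre[OF U] mem x that] by simp
  qed
  show open_infs_compact
    unfolding open_infs_compact_def
  proof (intro allI impI)
    fix U assume U: "openin X U"
    have b: "\<Sqinter>\<^bsub>L\<^esub> U \<in> carrier L" using inf_closed[OF openin_carrier[OF U]] .
    have "\<exists>d\<in>D. \<Sqinter>\<^bsub>L\<^esub> U \<sqsubseteq> d" if D: "directed_in L D" "\<Sqinter>\<^bsub>L\<^esub> U \<sqsubseteq> \<Squnion>\<^bsub>L\<^esub> D" for D
    proof -
      have Dc: "D \<subseteq> carrier L" using D by (simp add: directed_in_def)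
      have "\<Squnion>\<^bsub>L\<^esub> D \<in> {x \<in> carrier L. U \<in> t x}"
        using t_iff[OF U sup_closed[OF Dc]] D(2) sup_closed[OF Dc] by simp
      from directed_sup_in_open[OF D(1) pre[OF U] this] show ?thesis using t_iff[OF U] by auto
    qed
    then show "\<Sqinter>\<^bsub>L\<^esub> U \<in> compacts L" using b by (simp add: compacts_def)
  qed
  show open_infs_join
    unfolding open_infs_join_def
  proof (intro allI impI)
    fix U V assume U: "openin X U" and V: "openin X V"
    have c: "\<Sqinter>\<^bsub>L\<^esub> U \<in> carrier L" "\<Sqinter>\<^bsub>L\<^esub> V \<in> carrier L"
      using inf_closed openin_carrier U V by simp_all
    let ?x = "\<Sqinter>\<^bsub>L\<^esub> U \<squnion> \<Sqinter>\<^bsub>L\<^esub> V"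
    have x: "?x \<in> carrier L" using join_closed[OF c] .
    have "U \<in> t ?x" "V \<in> t ?x"
      using t_iff[OF U x] t_iff[OF V x] join_left[OF c] join_right[OF c] by simp_all
    then have "U \<inter> V \<in> t ?x" by (rule open_filter_Int[OF tf[OF x]])
    then show "\<Sqinter>\<^bsub>L\<^esub> (U \<inter> V) \<sqsubseteq> ?x" using t_iff[OF openin_Int[OF U V] x] by simp
  qed
qed

lemma open_infs_imp_split:
  assumes K: open_infs_compact and J: open_infs_join
  shows "\<exists>t. top_adjunction (F_space X) X \<alpha> t"
proof
  define t where "t x = {U. openin X U \<and> \<Sqinter>\<^bsub>L\<^esub> U \<sqsubseteq> x}" for x
  have tf: "open_filter X (t x)" if x: "x \<in> carrier L" for x
    unfolding open_filter_def
  proof (intro conjI ballI allI impI)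
    show "topspace X \<in> t x"
      using inf_lower[of "carrier L" x] x carrier_eq by (simp add: t_def)
    fix A assume A: "A \<in> t x"
    then have Ao: "openin X A" "\<Sqinter>\<^bsub>L\<^esub> A \<sqsubseteq> x" by (simp_all add: t_def)
    have Ac: "\<Sqinter>\<^bsub>L\<^esub> A \<in> carrier L" using inf_closed[OF openin_carrier[OF Ao(1)]] .
    show "openin X A" by fact
    show "A \<inter> B \<in> t x" if "B \<in> t x" for B
    proof -
      have Bo: "openin X B" "\<Sqinter>\<^bsub>L\<^esub> B \<sqsubseteq> x" using that by (simp_all add: t_def)
      have Bc: "\<Sqinter>\<^bsub>L\<^esub> B \<in> carrier L" using inf_closed[OF openin_carrier[OF Bo(1)]] .
      have AB: "openin X (A \<inter> B)" using openin_Int[OF Ao(1) Bo(1)] .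
      have "\<Sqinter>\<^bsub>L\<^esub> (A \<inter> B) \<sqsubseteq> \<Sqinter>\<^bsub>L\<^esub> A \<squnion> \<Sqinter>\<^bsub>L\<^esub> B"
        using J Ao(1) Bo(1) by (simp add: open_infs_join_def)
      then have "\<Sqinter>\<^bsub>L\<^esub> (A \<inter> B) \<sqsubseteq> x"
        using join_le[OF Ao(2) Bo(2) Ac Bc x] by (rule le_trans)
          (simp_all add: x Ac Bc inf_closed[OF openin_carrier[OF AB]])
      then show ?thesis using AB by (simp add: t_def)
    qed
    show "B \<in> t x" if B: "openin X B \<and> A \<subseteq> B" for B
    proof -
      have Bc: "B \<subseteq> carrier L" using B openin_carrier by simp
      have "\<Sqinter>\<^bsub>L\<^esub> B \<sqsubseteq> x"
        using le_trans[OF inf_antimono[of A B] Ao(2)] B Bc inf_closed[OF Bc] Ac x by simp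
      then show ?thesis using B by (simp add: t_def)
    qed
  qed
  have "continuous_map X (F_space X) t"
    unfolding F_space_def
  proof (rule continuous_on_generated_topo)
    fix W assume "W \<in> {sharp X A |A. openin X A}"
    then obtain A where A: "openin X A" "W = sharp X A" by blast
    \<comment> \<open>The preimage of a generating open is the up-set of the infimum of
      \<open>A\<close>, which is open because that infimum is compact.\<close>
    have "t -` W \<inter> topspace X = {y \<in> carrier L. \<Sqinter>\<^bsub>L\<^esub> A \<sqsubseteq> y}"
      using tf A carrier_eq by (auto simp: sharp_def t_def)
    moreover have "openin X {y \<in> carrier L. \<Sqinter>\<^bsub>L\<^esub> A \<sqsubseteq> y}"
      unfolding openin_iff_scott_open
      using K A(1) by (intro scott_open_above_compact) (simp add: open_infs_compact_def)
    ultimately show "openin X (t -` W \<inter> topspace X)" by simp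
  next
    have "t ` topspace X \<subseteq> sharp X (topspace X)"
      using tf open_filter_topspace carrier_eq by (auto simp: sharp_def)
    then show "t ` topspace X \<subseteq> \<Union> {sharp X A |A. openin X A}"
      using openin_topspace[of X] by blast
  qed
  moreover have "\<ff> \<sqsubseteq>\<^bsub>spec_order (F_space X)\<^esub> t (\<alpha> \<ff>)" if \<ff>: "open_filter X \<ff>" for \<ff>
    unfolding le_F_space_iff[OF \<ff> tf[OF alpha_closed[OF \<ff>]]]
    using open_filter_openin[OF \<ff>] inf_le_alpha[OF \<ff>] by (simp add: t_def subset_iff)
  moreover have "\<alpha> (t x) \<sqsubseteq>\<^bsub>spec_order X\<^esub> x" if x: "x \<in> topspace X" for x
  proof -
    have xc: "x \<in> carrier L" using x carrier_eq by simp
    have "\<alpha> (t x) \<sqsubseteq> x"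
      unfolding alpha_eq_sup_infs[OF tf[OF xc]]
    proof (rule sup_least[OF _ xc])
      show "{\<Sqinter>\<^bsub>L\<^esub> A |A. A \<in> t x} \<subseteq> carrier L"
        using open_filter_inf_closed[OF tf[OF xc]] by auto
      show "a \<sqsubseteq> x" if "a \<in> {\<Sqinter>\<^bsub>L\<^esub> A |A. A \<in> t x}" for a
        using that by (auto simp: t_def)
    qed
    then show ?thesis using le_spec_order_iff alpha_closed[OF tf[OF xc]] xc by simp
  qed
  ultimately show "top_adjunction (F_space X) X \<alpha> t"
    using continuous by (simp add: top_adjunction_def topspace_F_space)
qed

text \<open>Every \<open>x\<close> is the supremum of the infima of its open neighbourhoods; these
  are now compact elements below \<open>x\<close>, so the compact elements below \<open>x\<close>
  already have supremum \<open>x\<close>.\<close>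

lemma open_infs_imp_algebraic:
  assumes K: open_infs_compact
  shows "algebraic_lattice L"
  unfolding algebraic_lattice_def
proof (intro conjI ballI)
  show "complete_lattice L" ..
  fix x assume x: "x \<in> carrier L"
  let ?K = "{c \<in> compacts L. c \<sqsubseteq> x}" and ?I = "{\<Sqinter>\<^bsub>L\<^esub> A | A. openin X A \<and> x \<in> A}"
  have Kc: "?K \<subseteq> carrier L" using compacts_subset by blast
  show "directed_in L ?K"
    unfolding directed_in_def
  proof (intro conjI ballI)
    show "?K \<noteq> {}" using bottom_compact bottom_lower[OF x] by blast
    fix a b assume ab: "a \<in> ?K" "b \<in> ?K"
    then have c: "a \<in> carrier L" "b \<in> carrier L" using Kc by (simp_all add: subset_iff)
    have "a \<squnion> b \<in> ?K" using ab join_compact join_le[OF _ _ c x] by simp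
    then show "\<exists>z\<in>?K. a \<sqsubseteq> z \<and> b \<sqsubseteq> z" using join_left[OF c] join_right[OF c] by blast
  qed (rule Kc)
  have "?I \<subseteq> ?K"
    using K inf_lower openin_carrier by (auto simp: open_infs_compact_def)
  then have "\<Squnion>\<^bsub>L\<^esub> ?I \<sqsubseteq> \<Squnion>\<^bsub>L\<^esub> ?K"
    using Kc sup_upper[OF Kc] sup_closed[OF Kc] by (intro sup_least) auto
  then have "x \<sqsubseteq> \<Squnion>\<^bsub>L\<^esub> ?K" using eq_sup_of_infs[OF x] by simp
  moreover have "\<Squnion>\<^bsub>L\<^esub> ?K \<sqsubseteq> x" using sup_least[OF Kc x] by simp
  ultimately show "x = \<Squnion>\<^bsub>L\<^esub> ?K" using le_antisym x sup_closed[OF Kc] by simp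
qed

text \<open>A set \<open>S\<close> of compact elements is represented by the open union of its
  up-sets, which has the same infimum. Compactness of that infimum gives closure under infima. The
  join condition for this union and the up-set of \<open>a\<close> gives the nontrivial half of
  distributivity, since a point of their intersection lies above some
  \<open>a \<squnion> s\<close>.\<close>

lemma open_infs_imp_coframe:
  assumes K: open_infs_compact and J: open_infs_join
  shows "dual_of_frame (compact_poset L)"
proof -
  let ?up = "\<lambda>c. {y \<in> carrier L. c \<sqsubseteq> y}"
  have up: "openin X (?up c)" if "c \<in> compacts L" for c
    using scott_open_above_compact[OF that] openin_iff_scott_open by simp
  have Un: "openin X (\<Union>s\<in>S. ?up s)" if "S \<subseteq> compacts L" for S
    using up that by (intro openin_Union) (auto simp: subset_iff)
  have inf_Un: "\<Sqinter>\<^bsub>L\<^esub> (\<Union>s\<in>S. ?up s) = \<Sqinter>\<^bsub>L\<^esub> S" if S: "S \<subseteq> compacts L" for S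
  proof -
    have Sc: "S \<subseteq> carrier L" using S compacts_subset by (rule subset_trans)
    have Uc: "(\<Union>s\<in>S. ?up s) \<subseteq> carrier L" by blast
    have "S \<subseteq> (\<Union>s\<in>S. ?up s)" using Sc le_refl by blast
    then have "\<Sqinter>\<^bsub>L\<^esub> (\<Union>s\<in>S. ?up s) \<sqsubseteq> \<Sqinter>\<^bsub>L\<^esub> S" using inf_antimono Uc by simp
    moreover have "\<Sqinter>\<^bsub>L\<^esub> S \<sqsubseteq> \<Sqinter>\<^bsub>L\<^esub> (\<Union>s\<in>S. ?up s)"
    proof (rule inf_greatest[OF Uc inf_closed[OF Sc]])
      fix y assume "y \<in> (\<Union>s\<in>S. ?up s)"
      then obtain s where s: "s \<in> S" "y \<in> carrier L" "s \<sqsubseteq> y" by blast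
      then show "\<Sqinter>\<^bsub>L\<^esub> S \<sqsubseteq> y"
        using le_trans[OF inf_lower[OF Sc s(1)] s(3)] inf_closed[OF Sc] subsetD[OF Sc] by simp
    qed
    ultimately show ?thesis using le_antisym inf_closed[OF Sc] inf_closed[OF Uc] by simp
  qed
  have inf_compact: "\<Sqinter>\<^bsub>L\<^esub> S \<in> compacts L" if "S \<subseteq> compacts L" for S
    using K Un[OF that] inf_Un[OF that] by (metis open_infs_compact_def)
  have "is_glb (compact_poset L) (\<Sqinter>\<^bsub>L\<^esub> S) S" if S: "S \<subseteq> compacts L" for S
  proof -
    have Sc: "S \<subseteq> carrier L" using S compacts_subset by (rule subset_trans)
    show ?thesis
      unfolding compact_poset_glb_iff[OF S]
      using inf_compact[OF S] inf_lower[OF Sc] inf_greatest[OF Sc] subsetD[OF compacts_subset]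
      by simp
  qed
  moreover have "a \<squnion>\<^bsub>compact_poset L\<^esub> \<Sqinter>\<^bsub>compact_poset L\<^esub> S =
      \<Sqinter>\<^bsub>compact_poset L\<^esub> ((\<lambda>s. a \<squnion>\<^bsub>compact_poset L\<^esub> s) ` S)"
    if a: "a \<in> compacts L" and S: "S \<subseteq> compacts L" for a S
  proof -
    have Sc: "S \<subseteq> carrier L" using S compacts_subset by (rule subset_trans)
    have ac: "a \<in> carrier L" using a compacts_subset by blast
    let ?J = "(\<lambda>s. a \<squnion> s) ` S"
    have JK: "?J \<subseteq> compacts L" using join_compact[OF a] S by blast
    have Jc: "?J \<subseteq> carrier L" using JK compacts_subset by (rule subset_trans)
    have iS: "\<Sqinter>\<^bsub>L\<^esub> S \<in> carrier L" using inf_closed[OF Sc] .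
    have iJ: "\<Sqinter>\<^bsub>L\<^esub> ?J \<in> carrier L" using inf_closed[OF Jc] .
    have "a \<squnion> \<Sqinter>\<^bsub>L\<^esub> S \<sqsubseteq> \<Sqinter>\<^bsub>L\<^esub> ?J"
    proof (rule inf_greatest[OF Jc join_closed[OF ac iS]])
      fix z assume "z \<in> ?J"
      then obtain s where s: "s \<in> S" "z = a \<squnion> s" by blast
      have sc: "s \<in> carrier L" using s Sc by blast
      have "\<Sqinter>\<^bsub>L\<^esub> S \<sqsubseteq> a \<squnion> s"
        using le_trans[OF inf_lower[OF Sc s(1)] join_right[OF ac sc]] iS sc join_closed[OF ac sc]
        by simp
      then show "a \<squnion> \<Sqinter>\<^bsub>L\<^esub> S \<sqsubseteq> z"
        using join_le[OF join_left[OF ac sc] _ ac iS join_closed[OF ac sc]] s by simp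
    qed
    moreover have "\<Sqinter>\<^bsub>L\<^esub> ?J \<sqsubseteq> a \<squnion> \<Sqinter>\<^bsub>L\<^esub> S"
    proof -
      let ?V = "?up a \<inter> (\<Union>s\<in>S. ?up s)"
      have Vc: "?V \<subseteq> carrier L" by blast
      have "\<Sqinter>\<^bsub>L\<^esub> ?J \<sqsubseteq> \<Sqinter>\<^bsub>L\<^esub> ?V"
      proof (rule inf_greatest[OF Vc iJ])
        fix z assume "z \<in> ?V"
        then obtain s where s: "s \<in> S" "z \<in> carrier L" "a \<sqsubseteq> z" "s \<sqsubseteq> z" by blast
        have sc: "s \<in> carrier L" using s Sc by blast
        have "\<Sqinter>\<^bsub>L\<^esub> ?J \<sqsubseteq> a \<squnion> s" using inf_lower[OF Jc] s(1) by simp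
        then show "\<Sqinter>\<^bsub>L\<^esub> ?J \<sqsubseteq> z"
          using join_le[OF s(3,4) ac sc s(2)] iJ join_closed[OF ac sc] s(2) by (rule le_trans)
      qed
      moreover have "\<Sqinter>\<^bsub>L\<^esub> ?V \<sqsubseteq> \<Sqinter>\<^bsub>L\<^esub> (?up a) \<squnion> \<Sqinter>\<^bsub>L\<^esub> (\<Union>s\<in>S. ?up s)"
        using J up[OF a] Un[OF S] by (simp only: open_infs_join_def)
      ultimately show ?thesis
        unfolding inf_above[OF ac] inf_Un[OF S]
        using iJ inf_closed[OF Vc] join_closed[OF ac iS] by (rule le_trans)
    qed
    ultimately have eq: "a \<squnion> \<Sqinter>\<^bsub>L\<^esub> S = \<Sqinter>\<^bsub>L\<^esub> ?J"
      using le_antisym join_closed[OF ac iS] iJ by simp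
    have "(\<lambda>s. a \<squnion>\<^bsub>compact_poset L\<^esub> s) ` S = ?J"
      using join_compact_poset[OF a] S by (intro image_cong) (simp_all add: subset_iff)
    then show ?thesis
      using eq inf_compact_poset[OF S inf_compact[OF S]] inf_compact_poset[OF JK inf_compact[OF JK]]
        join_compact_poset[OF a inf_compact[OF S]] by simp
  qed
  ultimately show ?thesis unfolding dual_of_frame_compact_poset_iff by blast
qed

text \<open>Infima of compact elements taken in \<open>L\<close> and in the subposet of compact elements agree,
  because in an algebraic lattice the former are suprema of compact lower bounds.\<close>

lemma algebraic_coframe_imp_open_infs:
  assumes "algebraic_lattice_with_coframe_of_compacts L"
  shows "open_infs_compact" "open_infs_join"
proof -
  have alg: "algebraic_lattice L"
    and glb: "\<And>S. S \<subseteq> compacts L \<Longrightarrow> \<exists>g. is_glb (compact_poset L) g S"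
    and dist: "\<And>a S. a \<in> compacts L \<Longrightarrow> S \<subseteq> compacts L \<Longrightarrow>
      a \<squnion>\<^bsub>compact_poset L\<^esub> \<Sqinter>\<^bsub>compact_poset L\<^esub> S =
      \<Sqinter>\<^bsub>compact_poset L\<^esub> ((\<lambda>s. a \<squnion>\<^bsub>compact_poset L\<^esub> s) ` S)"
    using assms unfolding algebraic_lattice_with_coframe_of_compacts_def
      dual_of_frame_compact_poset_iff by simp_all
  have dir: "directed_in L {c \<in> compacts L. c \<sqsubseteq> x}"
    and sup: "\<Squnion>\<^bsub>L\<^esub> {c \<in> compacts L. c \<sqsubseteq> x} = x" if "x \<in> carrier L" for x
    using alg that unfolding algebraic_lattice_def by (blast, metis)
  have inf_compact: "\<Sqinter>\<^bsub>L\<^esub> S \<in> compacts L" if S: "S \<subseteq> compacts L" for S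
  proof -
    have Sc: "S \<subseteq> carrier L" using S compacts_subset by (rule subset_trans)
    obtain g where g: "g \<in> compacts L" "\<And>s. s \<in> S \<Longrightarrow> g \<sqsubseteq> s"
      "\<And>c. c \<in> compacts L \<Longrightarrow> (\<forall>s\<in>S. c \<sqsubseteq> s) \<Longrightarrow> c \<sqsubseteq> g"
      using glb[OF S] unfolding compact_poset_glb_iff[OF S] by blast
    have gc: "g \<in> carrier L" using g compacts_subset by blast
    have iS: "\<Sqinter>\<^bsub>L\<^esub> S \<in> carrier L" using inf_closed[OF Sc] .
    have "\<Squnion>\<^bsub>L\<^esub> {c \<in> compacts L. c \<sqsubseteq> \<Sqinter>\<^bsub>L\<^esub> S} \<sqsubseteq> g"
    proof (rule sup_least[OF _ gc])
      show "{c \<in> compacts L. c \<sqsubseteq> \<Sqinter>\<^bsub>L\<^esub> S} \<subseteq> carrier L" using compacts_subset by blast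
      fix c assume c: "c \<in> {c \<in> compacts L. c \<sqsubseteq> \<Sqinter>\<^bsub>L\<^esub> S}"
      then have cc: "c \<in> carrier L" "c \<sqsubseteq> \<Sqinter>\<^bsub>L\<^esub> S" using compacts_subset by (simp_all add: subset_iff)
      have "\<forall>s\<in>S. c \<sqsubseteq> s"
        using le_trans[OF cc(2) inf_lower[OF Sc]] cc(1) iS subsetD[OF Sc] by simp
      then show "c \<sqsubseteq> g" using g(3) c by simp
    qed
    then have "\<Sqinter>\<^bsub>L\<^esub> S \<sqsubseteq> g" using sup[OF iS] by simp
    moreover have "g \<sqsubseteq> \<Sqinter>\<^bsub>L\<^esub> S" using inf_greatest[OF Sc gc g(2)] .
    ultimately have "\<Sqinter>\<^bsub>L\<^esub> S = g" using le_antisym iS gc by simp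
    then show ?thesis using g(1) by simp
  qed
  \<comment> \<open>A point of \<open>U\<close> is a directed supremum of compact elements, one of
    which already lies in \<open>U\<close>; so \<open>U\<close> and its compact members have the
    same lower bounds.\<close>
  have inf_open: "\<Sqinter>\<^bsub>L\<^esub> U = \<Sqinter>\<^bsub>L\<^esub> (U \<inter> compacts L)" if U: "openin X U" for U
  proof -
    have Uc: "U \<subseteq> carrier L" using openin_carrier[OF U] .
    have UKc: "U \<inter> compacts L \<subseteq> carrier L" using Uc by blast
    have "\<Sqinter>\<^bsub>L\<^esub> (U \<inter> compacts L) \<sqsubseteq> \<Sqinter>\<^bsub>L\<^esub> U"
    proof (rule inf_greatest[OF Uc inf_closed[OF UKc]])
      fix u assume u: "u \<in> U"
      then have uc: "u \<in> carrier L" using Uc by blast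
      obtain c where c: "c \<in> compacts L" "c \<sqsubseteq> u" "c \<in> U"
        using directed_sup_in_open[OF dir[OF uc] U] sup[OF uc] u by auto
      then show "\<Sqinter>\<^bsub>L\<^esub> (U \<inter> compacts L) \<sqsubseteq> u"
        using le_trans[OF inf_lower[OF UKc] c(2)] inf_closed[OF UKc] uc subsetD[OF compacts_subset c(1)]
        by simp
    qed
    moreover have "\<Sqinter>\<^bsub>L\<^esub> U \<sqsubseteq> \<Sqinter>\<^bsub>L\<^esub> (U \<inter> compacts L)" using inf_antimono[OF _ Uc] by simp
    ultimately show ?thesis using le_antisym inf_closed[OF Uc] inf_closed[OF UKc] by simp
  qed
  have dist': "a \<squnion> \<Sqinter>\<^bsub>L\<^esub> S = \<Sqinter>\<^bsub>L\<^esub> ((\<lambda>s. a \<squnion> s) ` S)"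
    if a: "a \<in> compacts L" and S: "S \<subseteq> compacts L" for a S
  proof -
    have J: "(\<lambda>s. a \<squnion> s) ` S \<subseteq> compacts L" using join_compact[OF a] S by blast
    have "(\<lambda>s. a \<squnion>\<^bsub>compact_poset L\<^esub> s) ` S = (\<lambda>s. a \<squnion> s) ` S"
      using join_compact_poset[OF a] S by (intro image_cong) (simp_all add: subset_iff)
    then show ?thesis
      using dist[OF a S] inf_compact_poset[OF S inf_compact[OF S]]
        inf_compact_poset[OF J inf_compact[OF J]] join_compact_poset[OF a inf_compact[OF S]] by simp
  qed
  show open_infs_compact
    unfolding open_infs_compact_def using inf_open inf_compact by simp
  show open_infs_join
    unfolding open_infs_join_def
  proof (intro allI impI)
    fix U V assume U: "openin X U" and V: "openin X V"
    let ?a = "\<Sqinter>\<^bsub>L\<^esub> U" and ?UK = "U \<inter> compacts L" and ?VK = "V \<inter> compacts L"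
    have UV: "U \<inter> V \<subseteq> carrier L" using openin_carrier[OF U] by blast
    have iUV: "\<Sqinter>\<^bsub>L\<^esub> (U \<inter> V) \<in> carrier L" using inf_closed[OF UV] .
    have a: "?a \<in> compacts L" using inf_open[OF U] inf_compact by simp
    have Jc: "(\<lambda>s. b \<squnion> s) ` S \<subseteq> carrier L" if "b \<in> compacts L" "S \<subseteq> compacts L" for b S
      using join_compact[OF that(1)] that(2) compacts_subset by blast
    \<comment> \<open>Distributivity is applied twice. For fixed compact \<open>d\<close> in
      \<open>V\<close>, the join of \<open>d\<close> with the infimum of \<open>U\<close> is the
      infimum of all \<open>d \<squnion> c\<close> with \<open>c\<close> compact in
      \<open>U\<close>, and these lie in \<open>U \<inter> V\<close>. The second application ranges
      over \<open>d\<close>, with \<open>?a\<close> fixed; it is available because \<open>?a\<close>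
      is itself compact.\<close>
    have "\<Sqinter>\<^bsub>L\<^esub> (U \<inter> V) \<sqsubseteq> \<Sqinter>\<^bsub>L\<^esub> ((\<lambda>d. ?a \<squnion> d) ` ?VK)"
    proof (rule inf_greatest[OF Jc[OF a Int_lower2] iUV])
      fix z assume "z \<in> (\<lambda>d. ?a \<squnion> d) ` ?VK"
      then obtain d where d: "d \<in> V" "d \<in> compacts L" "z = ?a \<squnion> d" by blast
      have dc: "d \<in> carrier L" using d compacts_subset by blast
      have "z = d \<squnion> \<Sqinter>\<^bsub>L\<^esub> ?UK" using d(3) join_comm[of L] inf_open[OF U] by simp
      also have "\<dots> = \<Sqinter>\<^bsub>L\<^esub> ((\<lambda>c. d \<squnion> c) ` ?UK)" using dist'[OF d(2) Int_lower2] .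
      finally have z: "z = \<Sqinter>\<^bsub>L\<^esub> ((\<lambda>c. d \<squnion> c) ` ?UK)" .
      show "\<Sqinter>\<^bsub>L\<^esub> (U \<inter> V) \<sqsubseteq> z"
        unfolding z
      proof (rule inf_greatest[OF Jc[OF d(2) Int_lower2] iUV])
        fix y assume "y \<in> (\<lambda>c. d \<squnion> c) ` ?UK"
        then obtain c where c: "c \<in> U" "c \<in> compacts L" "y = d \<squnion> c" by blast
        have cc: "c \<in> carrier L" using c compacts_subset by blast
        have "y \<in> U \<inter> V"
          using c(3) open_upper[OF U c(1) join_closed[OF dc cc] join_right[OF dc cc]]
            open_upper[OF V d(1) join_closed[OF dc cc] join_left[OF dc cc]] by simp
        then show "\<Sqinter>\<^bsub>L\<^esub> (U \<inter> V) \<sqsubseteq> y" using inf_lower[OF UV] by simp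
      qed
    qed
    then show "\<Sqinter>\<^bsub>L\<^esub> (U \<inter> V) \<sqsubseteq> ?a \<squnion> \<Sqinter>\<^bsub>L\<^esub> V"
      using dist'[OF a Int_lower2, of V] inf_open[OF V] by simp
  qed
qed

lemma split_iff_algebraic_coframe:
  "split_F_algebra X \<alpha> \<longleftrightarrow> algebraic_lattice_with_coframe_of_compacts L"
  using F_algebra split_imp_open_infs open_infs_imp_split open_infs_imp_algebraic
    open_infs_imp_coframe algebraic_coframe_imp_open_infs
  unfolding split_F_algebra_def algebraic_lattice_with_coframe_of_compacts_def by meson

end

(* The first three conjuncts say that (X, alpha) |-> spec_order X, with inverse
   L |-> scott_topology L, identifies the Eilenberg-Moore category with ContLat, identically on
   maps.  The last two say that under it the split algebras are exactly the objects of the full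
   subcategory in question. *)
theorem theorem6p4:
  shows "(\<forall>(X :: 'a topology) \<alpha>. F_algebra X \<alpha> \<longrightarrow>
            continuous_lattice (spec_order X) \<and> scott_topology (spec_order X) = X) \<and>
         (\<forall>L :: 'a gorder. continuous_lattice L \<longrightarrow>
            (\<exists>\<alpha>. F_algebra (scott_topology L) \<alpha>) \<and>
            same_poset (spec_order (scott_topology L)) L) \<and>
         (\<forall>(X :: 'a topology) \<alpha> (Y :: 'b topology) \<beta> f. F_algebra X \<alpha> \<and> F_algebra Y \<beta> \<longrightarrow>
            (F_hom X \<alpha> Y \<beta> f \<longleftrightarrow> ContLat_hom (spec_order X) (spec_order Y) f)) \<and>
         (\<forall>(X :: 'a topology) \<alpha>. F_algebra X \<alpha> \<longrightarrow>
            (split_F_algebra X \<alpha> \<longleftrightarrow>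
             algebraic_lattice_with_coframe_of_compacts (spec_order X))) \<and>
         (\<forall>L :: 'a gorder. algebraic_lattice_with_coframe_of_compacts L \<longrightarrow>
            continuous_lattice L \<and> (\<exists>\<alpha>. split_F_algebra (scott_topology L) \<alpha>))"
proof (intro conjI allI impI)
  fix X :: "'a topology" and \<alpha> assume A: "F_algebra X \<alpha>"
  interpret kz_algebra "spec_order X" X \<alpha> by (rule kz_algebra_spec_order[OF A])
  show "continuous_lattice (spec_order X)" by (rule continuous_lattice)
  show "scott_topology (spec_order X) = X" by (rule scott_topology_eq)
  show "split_F_algebra X \<alpha> \<longleftrightarrow> algebraic_lattice_with_coframe_of_compacts (spec_order X)"
    by (rule split_iff_algebraic_coframe)
next
  fix L :: "'a gorder" assume L: "continuous_lattice L"
  then interpret gorder_complete_lattice L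
    by (simp add: continuous_lattice_def gorder_complete_lattice_def)
  \<comment> \<open>The order used here is \<open>L\<close> itself, so the conclusions speak of
    \<open>L\<close> directly; its agreement with the specialisation order on the carrier is then a
    consequence.\<close>
  interpret kz_algebra L "scott_topology L" "\<lambda>\<ff>. \<Squnion>\<^bsub>L\<^esub> {\<Sqinter>\<^bsub>L\<^esub> A | A. A \<in> \<ff>}"
    by (rule kz_algebra_scott[OF L])
  show "\<exists>\<alpha>. F_algebra (scott_topology L) \<alpha>" by (rule exI, rule F_algebra)
  have "carrier (spec_order (scott_topology L)) = carrier L"
    using carrier_eq by (simp add: spec_order_def)
  then show "same_poset (spec_order (scott_topology L)) L"
    using le_spec_order_iff by (simp add: same_poset_def)
next
  fix X :: "'a topology" and \<alpha> and Y :: "'b topology" and \<beta> f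
  assume "F_algebra X \<alpha> \<and> F_algebra Y \<beta>"
  then show "F_hom X \<alpha> Y \<beta> f \<longleftrightarrow> ContLat_hom (spec_order X) (spec_order Y) f"
    by (intro F_hom_iff_ContLat_hom kz_algebra_spec_order) simp_all
next
  fix L :: "'a gorder" assume L: "algebraic_lattice_with_coframe_of_compacts L"
  then interpret gorder_complete_lattice L
    by (simp add: algebraic_lattice_with_coframe_of_compacts_def algebraic_lattice_def
        gorder_complete_lattice_def)
  show cont: "continuous_lattice L"
    using L algebraic_imp_continuous_lattice
    by (simp add: algebraic_lattice_with_coframe_of_compacts_def)
  interpret kz_algebra L "scott_topology L" "\<lambda>\<ff>. \<Squnion>\<^bsub>L\<^esub> {\<Sqinter>\<^bsub>L\<^esub> A | A. A \<in> \<ff>}"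
    by (rule kz_algebra_scott[OF cont])
  show "\<exists>\<alpha>. split_F_algebra (scott_topology L) \<alpha>"
    by (rule exI, rule iffD2[OF split_iff_algebraic_coframe L])
qed

end
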